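(* Let $\Omega\subset\mathbb{R}^N$ be a bounded open set, $\sigma>0$, $h:[0,\sigma)\to\mathbb{R}^+$ continuous, strictly increasing with $\lim_{s\to\sigma^-}h(s)=+\infty$, and suppose there exists $\gamma\in[1,2)$ with $\lim_{s\to\sigma^-}(\sigma-s)^\gamma h(s)=C>0$. Let $f\in L^p(\Omega)$, $p>N/2$, with $f\ge\rho$ in $\Omega$ for some $\rho>0$. Let $H(s)=\int_0^s h$, $\psi(s)=\int_0^s e^{-H(t)}dt$, $L=\psi(\sigma)$, and $g(s)=e^{-H(\psi^{-1}(s))}$ on $[0,L]$ ($g(L)=0$). Then for every $\lambda>0$ there exists a unique $v_\lambda\in H^1_0(\Omega)$ with $0\le v_\lambda\le L$ a.e. solving $$-\Delta v=\lambda f\,g(v)\text{ in }\Omega,\qquad v=0\text{ on }\partial\Omega,$$ i.e. $\int_\Omega\nabla v_\lambda\cdot\nabla\varphi=\lambda\int_\Omega f\,g(v_\lambda)\varphi$ for all $\varphi\in H^1_0(\Omega)$. *)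

theory Defs
  imports "HOL-Analysis.Analysis"
begin

definition C1c_test :: "'a::euclidean_space set \<Rightarrow> ('a \<Rightarrow> real) \<Rightarrow> ('a \<Rightarrow> 'a) \<Rightarrow> bool" where
  "C1c_test \<Omega> \<phi> D \<longleftrightarrow>
     (\<forall>x. (\<phi> has_derivative (\<lambda>y. D x \<bullet> y)) (at x)) \<and> continuous_on UNIV D \<and>
     compact (closure {x. \<phi> x \<noteq> 0}) \<and> closure {x. \<phi> x \<noteq> 0} \<subseteq> \<Omega>"

definition L2_on :: "'a::euclidean_space set \<Rightarrow> ('a \<Rightarrow> real) \<Rightarrow> bool" where
  "L2_on \<Omega> u \<longleftrightarrow> u \<in> borel_measurable (lebesgue_on \<Omega>) \<and>
     integrable (lebesgue_on \<Omega>) (\<lambda>x. (u x)\<^sup>2)"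

definition L2_vec_on :: "'a::euclidean_space set \<Rightarrow> ('a \<Rightarrow> 'a) \<Rightarrow> bool" where
  "L2_vec_on \<Omega> G \<longleftrightarrow> G \<in> borel_measurable (lebesgue_on \<Omega>) \<and>
     integrable (lebesgue_on \<Omega>) (\<lambda>x. (norm (G x))\<^sup>2)"

definition Lp_on :: "'a::euclidean_space set \<Rightarrow> real \<Rightarrow> ('a \<Rightarrow> real) \<Rightarrow> bool" where
  "Lp_on \<Omega> p u \<longleftrightarrow> u \<in> borel_measurable (lebesgue_on \<Omega>) \<and>
     integrable (lebesgue_on \<Omega>) (\<lambda>x. \<bar>u x\<bar> powr p)"

text \<open>H^1_0(Omega): closure of compactly supported test functions in the H^1 norm.
  H10 Omega v G means v \<in> H^1_0(Omega) with (weak) gradient G.\<close>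
definition H10 :: "'a::euclidean_space set \<Rightarrow> ('a \<Rightarrow> real) \<Rightarrow> ('a \<Rightarrow> 'a) \<Rightarrow> bool" where
  "H10 \<Omega> v G \<longleftrightarrow> L2_on \<Omega> v \<and> L2_vec_on \<Omega> G \<and>
     (\<exists>\<phi> D. (\<forall>k. C1c_test \<Omega> (\<phi> k) (D k)) \<and>
        (\<lambda>k. LINT x|lebesgue_on \<Omega>. (\<phi> k x - v x)\<^sup>2) \<longlonglongrightarrow> 0 \<and>
        (\<lambda>k. LINT x|lebesgue_on \<Omega>. (norm (D k x - G x))\<^sup>2) \<longlonglongrightarrow> 0)"

definition Hf :: "(real \<Rightarrow> real) \<Rightarrow> real \<Rightarrow> real" where
  "Hf h s = integral {0..s} h"

definition psi :: "(real \<Rightarrow> real) \<Rightarrow> real \<Rightarrow> real" where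
  "psi h s = integral {0..s} (\<lambda>t. exp (- Hf h t))"

definition Lval :: "(real \<Rightarrow> real) \<Rightarrow> real \<Rightarrow> real" where
  "Lval h \<sigma> = integral {0..<\<sigma>} (\<lambda>t. exp (- Hf h t))"

definition gf :: "(real \<Rightarrow> real) \<Rightarrow> real \<Rightarrow> real \<Rightarrow> real" where
  "gf h \<sigma> s = (if s < Lval h \<sigma> then exp (- Hf h (the_inv_into {0..<\<sigma>} (psi h) s)) else 0)"

end

theory Submission
  imports Defs
begin

text \<open>
  Since \<open>\<gamma> \<ge> 1\<close>, \<open>H\<close> diverges at \<open>\<sigma>\<close>; hence \<open>g\<close> is continuous and antitone on \<open>[0, \<infinity>)\<close>, vanishes from
  \<open>L\<close> on, and, extended to the left of \<open>0\<close> by \<open>g 0\<close>, is minus the derivative of a nonnegative convex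
  function \<open>F\<close>. The energy \<open>1/2 \<integral> |\<nabla>v|\<^sup>2 + \<lambda> \<integral> f F(v)\<close> is minimised over test functions: the
  parallelogram law makes the gradients of a minimising sequence Cauchy, the Poincare inequality gives
  a limit in \<open>H\<^sup>1\<^sub>0\<close>, and the limit solves the equation against test functions. Testing with smoothed
  positive parts bounds \<open>\<lambda> \<integral> f g(v) |\<psi>|\<close> by \<open>2 \<parallel>\<nabla>v\<parallel> \<parallel>\<nabla>\<psi>\<parallel>\<close>, which extends the equation to all of
  \<open>H\<^sup>1\<^sub>0\<close> without a Sobolev embedding, knowing only that \<open>f\<close> is integrable. The bounds \<open>0 \<le> v \<le> L\<close> and
  uniqueness follow by testing the equation, or the difference of two equations, with \<open>\<theta>(v)\<close> for a
  nondecreasing \<open>\<theta>\<close>.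
\<close>

section \<open>Square-integrable functions\<close>

definition square_integrable :: "'x measure \<Rightarrow> ('x \<Rightarrow> 'b::euclidean_space) \<Rightarrow> bool" where
  "square_integrable M u \<longleftrightarrow> u \<in> borel_measurable M \<and> integrable M (\<lambda>x. (norm (u x))\<^sup>2)"

definition sq_norm :: "'x measure \<Rightarrow> ('x \<Rightarrow> 'b::euclidean_space) \<Rightarrow> real" where
  "sq_norm M u = (LINT x|M. (norm (u x))\<^sup>2)"

lemma square_integrableD:
  assumes "square_integrable M u"
  shows "u \<in> borel_measurable M" "integrable M (\<lambda>x. (norm (u x))\<^sup>2)"
  using assms by (auto simp: square_integrable_def)

lemma square_integrable_dominated:
  fixes u :: "'x \<Rightarrow> 'b::euclidean_space"
  assumes "integrable M w" "u \<in> borel_measurable M" "\<And>x. (norm (u x))\<^sup>2 \<le> w x"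
  shows "square_integrable M u"
proof -
  have "integrable M (\<lambda>x. (norm (u x))\<^sup>2)"
    using assms(2,3)
    by (intro Bochner_Integration.integrable_bound[OF assms(1)])
       (auto intro: order_trans[OF _ abs_ge_self])
  then show ?thesis
    using assms(2) by (simp add: square_integrable_def)
qed

lemma sq_norm_nonneg [simp]: "0 \<le> sq_norm M u"
  by (simp add: sq_norm_def)

lemma sq_norm_eq_0_iff_AE:
  assumes "square_integrable M u"
  shows "sq_norm M u = 0 \<longleftrightarrow> (AE x in M. u x = 0)"
  unfolding sq_norm_def using integral_nonneg_eq_0_iff_AE[OF square_integrableD(2)[OF assms]]
  by simp

lemma sq_norm_mono:
  assumes "square_integrable M u" "square_integrable M v" "\<And>x. (norm (u x))\<^sup>2 \<le> c * (norm (v x))\<^sup>2"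
  shows "sq_norm M u \<le> c * sq_norm M v"
proof -
  have "sq_norm M u \<le> (LINT x|M. c * (norm (v x))\<^sup>2)"
    unfolding sq_norm_def using assms by (intro integral_mono) (auto dest: square_integrableD)
  then show ?thesis
    by (simp add: sq_norm_def)
qed

lemma norm_add_square_le:
  fixes a b :: "'b::real_normed_vector"
  shows "(norm (a + b))\<^sup>2 \<le> 2 * (norm a)\<^sup>2 + 2 * (norm b)\<^sup>2"
proof -
  have "(norm (a + b))\<^sup>2 \<le> (norm a + norm b)\<^sup>2"
    by (intro power_mono norm_triangle_ineq) auto
  also have "\<dots> \<le> 2 * (norm a)\<^sup>2 + 2 * (norm b)\<^sup>2"
    using sum_squares_bound[of "norm a" "norm b"] by (simp add: power2_sum)
  finally show ?thesis .
qed

lemma square_integrable_add: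
  assumes "square_integrable M u" "square_integrable M v"
  shows "square_integrable M (\<lambda>x. u x + v x)"
  using assms
  by (intro square_integrable_dominated[where w = "\<lambda>x. 2 * (norm (u x))\<^sup>2 + 2 * (norm (v x))\<^sup>2"])
     (auto simp: square_integrable_def norm_add_square_le)

lemma square_integrable_mult_bounded:
  assumes "m \<in> borel_measurable M" "\<And>x. \<bar>m x\<bar> \<le> B" "square_integrable M u"
  shows "square_integrable M (\<lambda>x. m x *\<^sub>R u x)"
    and "sq_norm M (\<lambda>x. m x *\<^sub>R u x) \<le> B\<^sup>2 * sq_norm M u"
proof -
  have "(m x)\<^sup>2 \<le> B\<^sup>2" for x
    using power_mono[OF assms(2), of x 2] by simp
  then have bound: "(norm (m x *\<^sub>R u x))\<^sup>2 \<le> B\<^sup>2 * (norm (u x))\<^sup>2" for x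
    by (simp add: power_mult_distrib mult_right_mono)
  show sq: "square_integrable M (\<lambda>x. m x *\<^sub>R u x)"
    using assms(1,3) bound
    by (intro square_integrable_dominated[where w = "\<lambda>x. B\<^sup>2 * (norm (u x))\<^sup>2"])
       (auto simp: square_integrable_def)
  show "sq_norm M (\<lambda>x. m x *\<^sub>R u x) \<le> B\<^sup>2 * sq_norm M u"
    by (rule sq_norm_mono[OF sq assms(3) bound])
qed

lemma square_integrable_uminus:
  "square_integrable M u \<Longrightarrow> square_integrable M (\<lambda>x. - u x)"
  by (simp add: square_integrable_def)

lemma square_integrable_diff:
  assumes "square_integrable M u" "square_integrable M v"
  shows "square_integrable M (\<lambda>x. u x - v x)"
  using square_integrable_add[OF assms(1) square_integrable_uminus[OF assms(2)]] by simp

lemma sq_norm_add_le: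
  assumes "square_integrable M u" "square_integrable M v"
  shows "sq_norm M (\<lambda>x. u x + v x) \<le> 2 * sq_norm M u + 2 * sq_norm M v"
proof -
  have "sq_norm M (\<lambda>x. u x + v x) \<le> (LINT x|M. 2 * (norm (u x))\<^sup>2 + 2 * (norm (v x))\<^sup>2)"
    unfolding sq_norm_def using square_integrable_add[OF assms] assms
    by (intro integral_mono) (auto simp: square_integrable_def norm_add_square_le)
  also have "\<dots> = 2 * sq_norm M u + 2 * sq_norm M v"
    unfolding sq_norm_def using assms by (simp add: square_integrable_def)
  finally show ?thesis .
qed

lemma sq_norm_diff_le:
  assumes "square_integrable M u" "square_integrable M v"
  shows "sq_norm M (\<lambda>x. u x - v x) \<le> 2 * sq_norm M u + 2 * sq_norm M v"
  using sq_norm_add_le[OF assms(1) square_integrable_uminus[OF assms(2)]] by (simp add: sq_norm_def)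

lemma square_integrable_inner:
  assumes "square_integrable M u" "square_integrable M v"
  shows "integrable M (\<lambda>x. u x \<bullet> v x)"
proof (rule Bochner_Integration.integrable_bound)
  show "integrable M (\<lambda>x. (norm (u x))\<^sup>2 + (norm (v x))\<^sup>2)"
    using assms by (auto simp: square_integrable_def)
  have "\<bar>u x \<bullet> v x\<bar> \<le> (norm (u x))\<^sup>2 + (norm (v x))\<^sup>2" for x
    using Cauchy_Schwarz_ineq2[of "u x" "v x"] sum_squares_bound[of "norm (u x)" "norm (v x)"]
      zero_le_mult_iff[of "norm (u x)" "norm (v x)"] by simp
  then show "AE x in M. norm (u x \<bullet> v x) \<le> norm ((norm (u x))\<^sup>2 + (norm (v x))\<^sup>2)"
    by simp
qed (use assms[THEN square_integrableD(1)] in measurable)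

lemma sq_norm_add_scaleR:
  assumes "square_integrable M u" "square_integrable M v"
  shows "sq_norm M (\<lambda>x. u x + t *\<^sub>R v x)
    = sq_norm M u + 2 * t * (LINT x|M. u x \<bullet> v x) + t\<^sup>2 * sq_norm M v"
proof -
  have "(norm (u x + t *\<^sub>R v x))\<^sup>2 = (norm (u x))\<^sup>2 + 2 * t * (u x \<bullet> v x) + t\<^sup>2 * (norm (v x))\<^sup>2" for x
    unfolding power2_norm_eq_inner
    by (simp add: inner_add inner_commute power2_eq_square algebra_simps)
  then show ?thesis
    using assms square_integrable_inner[OF assms] by (simp add: sq_norm_def square_integrable_def)
qed

lemma parallelogram_law_sq_norm:
  assumes "square_integrable M u" "square_integrable M v"
  shows "4 * sq_norm M (\<lambda>x. (1/2) *\<^sub>R u x + (1/2) *\<^sub>R v x) + sq_norm M (\<lambda>x. u x - v x)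
    = 2 * sq_norm M u + 2 * sq_norm M v"
proof -
  have "sq_norm M (\<lambda>x. (1/2) *\<^sub>R u x + (1/2) *\<^sub>R v x) = sq_norm M (\<lambda>x. (1/2) *\<^sub>R (u x + 1 *\<^sub>R v x))"
    by (simp add: scaleR_add_right)
  also have "\<dots> = sq_norm M (\<lambda>x. u x + 1 *\<^sub>R v x) / 4"
    by (simp add: sq_norm_def power_divide)
  finally show ?thesis
    using sq_norm_add_scaleR[OF assms, of 1] sq_norm_add_scaleR[OF assms, of "-1"] by simp
qed

lemma Cauchy_Schwarz_sq_norm:
  assumes "square_integrable M u" "square_integrable M v"
  shows "\<bar>LINT x|M. u x \<bullet> v x\<bar> \<le> sqrt (sq_norm M u) * sqrt (sq_norm M v)"
proof -
  let ?A = "sq_norm M u" and ?B = "LINT x|M. u x \<bullet> v x" and ?C = "sq_norm M v"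
  have nonneg: "0 \<le> ?A + 2 * t * ?B + t\<^sup>2 * ?C" for t
    using sq_norm_nonneg[of M "\<lambda>x. u x + t *\<^sub>R v x"] sq_norm_add_scaleR[OF assms, of t] by simp
  have "?B\<^sup>2 \<le> ?A * ?C"
  proof (cases "?C = 0")
    case True
    have "?B = 0"
    proof (rule ccontr)
      assume "?B \<noteq> 0"
      then show False
        using nonneg[of "- (?A + 1) / (2 * ?B)"] True by (simp add: field_simps)
    qed
    then show ?thesis using True by simp
  next
    case False
    then have "?C > 0"
      using sq_norm_nonneg[of M v] by linarith
    then have "?A + 2 * (- ?B / ?C) * ?B + (- ?B / ?C)\<^sup>2 * ?C = ?A - ?B\<^sup>2 / ?C"
      by (simp add: field_simps power2_eq_square)
    then have "?B\<^sup>2 / ?C \<le> ?A"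
      using nonneg[of "- ?B / ?C"] by simp
    then show ?thesis
      using \<open>?C > 0\<close> by (simp add: field_simps)
  qed
  then show ?thesis
    using real_sqrt_le_mono[of "?B\<^sup>2" "?A * ?C"] by (simp add: real_sqrt_mult)
qed

lemma sq_norm_le_of_le_integral_inner:
  assumes "square_integrable M u" "square_integrable M v" "sq_norm M u \<le> \<bar>LINT x|M. u x \<bullet> v x\<bar>"
  shows "sq_norm M u \<le> sq_norm M v"
proof (rule ccontr)
  assume "\<not> ?thesis"
  then have "sq_norm M v < sq_norm M u" "0 < sq_norm M u"
    using sq_norm_nonneg[of M v] by linarith+
  then have "sqrt (sq_norm M u) * sqrt (sq_norm M v) < sqrt (sq_norm M u) * sqrt (sq_norm M u)"
    by (intro mult_strict_left_mono) auto
  then show False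
    using Cauchy_Schwarz_sq_norm[OF assms(1,2)] assms(3) by simp
qed

subsection \<open>Convergence in mean square\<close>

definition L2_tendsto ::
    "'x measure \<Rightarrow> (nat \<Rightarrow> 'x \<Rightarrow> 'b::euclidean_space) \<Rightarrow> ('x \<Rightarrow> 'b) \<Rightarrow> bool" where
  "L2_tendsto M u v \<longleftrightarrow> (\<forall>k. square_integrable M (u k)) \<and> square_integrable M v \<and>
     (\<lambda>k. sq_norm M (\<lambda>x. u k x - v x)) \<longlonglongrightarrow> 0"

definition L2_Cauchy :: "'x measure \<Rightarrow> (nat \<Rightarrow> 'x \<Rightarrow> 'b::euclidean_space) \<Rightarrow> bool" where
  "L2_Cauchy M u \<longleftrightarrow> (\<forall>k. square_integrable M (u k)) \<and>
     (\<forall>e>0. \<exists>N. \<forall>j\<ge>N. \<forall>k\<ge>N. sq_norm M (\<lambda>x. u j x - u k x) < e)"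

lemma L2_tendstoD:
  assumes "L2_tendsto M u v"
  shows "square_integrable M (u k)" "square_integrable M v"
    "(\<lambda>k. sq_norm M (\<lambda>x. u k x - v x)) \<longlonglongrightarrow> 0"
  using assms by (auto simp: L2_tendsto_def)

lemma L2_tendsto_const: "square_integrable M v \<Longrightarrow> L2_tendsto M (\<lambda>_. v) v"
  by (simp add: L2_tendsto_def sq_norm_def)

lemma L2_tendsto_dominated:
  assumes "\<And>k. square_integrable M (u k)" "square_integrable M v"
    and "\<And>k. sq_norm M (\<lambda>x. u k x - v x) \<le> a k" "a \<longlonglongrightarrow> 0"
  shows "L2_tendsto M u v"
  unfolding L2_tendsto_def using assms
  by (auto intro: tendsto_sandwich[where f = "\<lambda>_. 0" and h = a])

lemma L2_tendsto_diff:
  assumes "L2_tendsto M u v" "L2_tendsto M u' v'"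
  shows "L2_tendsto M (\<lambda>k x. u k x - u' k x) (\<lambda>x. v x - v' x)"
proof (rule L2_tendsto_dominated)
  show "sq_norm M (\<lambda>x. u k x - u' k x - (v x - v' x))
      \<le> 2 * sq_norm M (\<lambda>x. u k x - v x) + 2 * sq_norm M (\<lambda>x. u' k x - v' x)" for k
    using sq_norm_diff_le[OF square_integrable_diff[OF L2_tendstoD(1,2)[OF assms(1)]]
        square_integrable_diff[OF L2_tendstoD(1,2)[OF assms(2)]], of k k]
    by (simp add: algebra_simps)
  show "(\<lambda>k. 2 * sq_norm M (\<lambda>x. u k x - v x) + 2 * sq_norm M (\<lambda>x. u' k x - v' x)) \<longlonglongrightarrow> 0"
    using L2_tendstoD(3)[OF assms(1)] L2_tendstoD(3)[OF assms(2)]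
    by (auto intro!: tendsto_eq_intros)
qed (intro square_integrable_diff L2_tendstoD(1,2)[OF assms(1)] L2_tendstoD(1,2)[OF assms(2)])+

lemma L2_tendsto_subseq:
  assumes "L2_tendsto M u v" "strict_mono r"
  shows "L2_tendsto M (\<lambda>k. u (r k)) v"
  using assms LIMSEQ_subseq_LIMSEQ[OF L2_tendstoD(3)] by (fastforce simp: L2_tendsto_def o_def)

lemma L2_tendsto_AE_subseq:
  assumes "L2_tendsto M u v"
  obtains r where "strict_mono r" "AE x in M. (\<lambda>k. u (r k) x) \<longlonglongrightarrow> v x"
proof -
  have "integrable M (\<lambda>x. (norm (u k x - v x))\<^sup>2)" for k
    using square_integrable_diff[OF L2_tendstoD(1,2)[OF assms]] by (simp add: square_integrable_def)
  then obtain r where "strict_mono r"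
    and lim: "AE x in M. (\<lambda>k. (norm (u (r k) x - v x))\<^sup>2) \<longlonglongrightarrow> 0"
    using tendsto_L1_AE_subseq[of M "\<lambda>k x. (norm (u k x - v x))\<^sup>2"] L2_tendstoD(3)[OF assms]
    by (auto simp: sq_norm_def)
  have "AE x in M. (\<lambda>k. u (r k) x) \<longlonglongrightarrow> v x"
    using lim
  proof eventually_elim
    case (elim x)
    from tendsto_real_sqrt[OF elim] have "(\<lambda>k. norm (u (r k) x - v x)) \<longlonglongrightarrow> 0" by simp
    then show ?case by (simp add: LIM_zero_iff tendsto_norm_zero_iff)
  qed
  then show thesis using \<open>strict_mono r\<close> that by blast
qed

lemma L2_tendsto_integral_inner:
  assumes "square_integrable M u" "L2_tendsto M v w"
  shows "(\<lambda>k. LINT x|M. u x \<bullet> v k x) \<longlonglongrightarrow> (LINT x|M. u x \<bullet> w x)"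
proof -
  let ?bound = "\<lambda>k. sqrt (sq_norm M u) * sqrt (sq_norm M (\<lambda>x. v k x - w x))"
  note v = L2_tendstoD(1)[OF assms(2)] and w = L2_tendstoD(2)[OF assms(2)]
  have "norm ((LINT x|M. u x \<bullet> v k x) - (LINT x|M. u x \<bullet> w x)) \<le> ?bound k" for k
    using Cauchy_Schwarz_sq_norm[OF assms(1) square_integrable_diff[OF v w], of k]
      square_integrable_inner[OF assms(1) v, of k] square_integrable_inner[OF assms(1) w]
    by (simp add: inner_diff_right)
  moreover have "?bound \<longlonglongrightarrow> 0"
    by (auto intro!: tendsto_eq_intros L2_tendstoD(3)[OF assms(2)])
  ultimately have "(\<lambda>k. (LINT x|M. u x \<bullet> v k x) - (LINT x|M. u x \<bullet> w x)) \<longlonglongrightarrow> 0"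
    by (rule Lim_null_comparison[OF always_eventually, OF allI])
  then show ?thesis by (simp add: LIM_zero_iff)
qed

lemma L2_tendsto_sq_norm:
  assumes "L2_tendsto M u v"
  shows "(\<lambda>k. sq_norm M (u k)) \<longlonglongrightarrow> sq_norm M v"
proof -
  note v = L2_tendstoD(2)[OF assms]
  have "sq_norm M (\<lambda>x. u k x - v x)
      = sq_norm M (u k) - 2 * (LINT x|M. v x \<bullet> u k x) + sq_norm M v" for k
    using sq_norm_add_scaleR[OF L2_tendstoD(1)[OF assms, of k] v, of "-1"]
    by (simp add: inner_commute)
  then have "sq_norm M (u k)
      = sq_norm M (\<lambda>x. u k x - v x) + 2 * (LINT x|M. v x \<bullet> u k x) - sq_norm M v" for k
    by simp
  moreover have "(LINT x|M. v x \<bullet> v x) = sq_norm M v"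
    by (simp add: sq_norm_def power2_norm_eq_inner)
  ultimately show ?thesis
    using L2_tendstoD(3)[OF assms] L2_tendsto_integral_inner[OF v assms]
    by (auto intro!: tendsto_eq_intros)
qed

lemma L2_tendsto_compose_lipschitz:
  fixes \<theta> :: "'b::euclidean_space \<Rightarrow> 'c::euclidean_space"
  assumes "L2_tendsto M u v" and \<theta>: "B-lipschitz_on UNIV \<theta>" "\<theta> 0 = 0"
  shows "L2_tendsto M (\<lambda>k x. \<theta> (u k x)) (\<lambda>x. \<theta> (v x))"
proof (rule L2_tendsto_dominated)
  have [measurable]: "\<theta> \<in> borel_measurable borel"
    by (rule borel_measurable_continuous_onI[OF lipschitz_on_continuous_on[OF \<theta>(1)]])
  have lip: "(norm (\<theta> a - \<theta> b))\<^sup>2 \<le> B\<^sup>2 * (norm (a - b))\<^sup>2" for a b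
    using power_mono[OF lipschitz_onD[OF \<theta>(1), of a b], of 2]
    by (simp add: dist_norm power_mult_distrib)
  have sq: "square_integrable M (\<lambda>x. \<theta> (w x))" if w: "square_integrable M w" for w
  proof (rule square_integrable_dominated)
    show "integrable M (\<lambda>x. B\<^sup>2 * (norm (w x))\<^sup>2)"
      using square_integrableD(2)[OF w] by simp
    show "(norm (\<theta> (w x)))\<^sup>2 \<le> B\<^sup>2 * (norm (w x))\<^sup>2" for x
      using lip[of "w x" 0] \<theta>(2) by simp
  qed (use square_integrableD(1)[OF w] in measurable)
  show "square_integrable M (\<lambda>x. \<theta> (u k x))" "square_integrable M (\<lambda>x. \<theta> (v x))" for k
    by (intro sq L2_tendstoD(1,2)[OF assms(1)])+
  then show "sq_norm M (\<lambda>x. \<theta> (u k x) - \<theta> (v x)) \<le> B\<^sup>2 * sq_norm M (\<lambda>x. u k x - v x)" for k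
    by (intro sq_norm_mono square_integrable_diff lip L2_tendstoD(1,2)[OF assms(1)])
  show "(\<lambda>k. B\<^sup>2 * sq_norm M (\<lambda>x. u k x - v x)) \<longlonglongrightarrow> 0"
    using L2_tendstoD(3)[OF assms(1)] by (auto intro!: tendsto_eq_intros)
qed

text \<open>\<open>m\<^sub>k u\<^sub>k - m v = m\<^sub>k (u\<^sub>k - v) + (m\<^sub>k - m) v\<close>; the second summand is dominated by \<open>2 B |v|\<close>.\<close>

lemma L2_tendsto_mult_bounded:
  fixes m :: "nat \<Rightarrow> 'x \<Rightarrow> real"
  assumes "L2_tendsto M u v"
    and [measurable]: "\<And>k. m k \<in> borel_measurable M" "m' \<in> borel_measurable M"
    and bound: "\<And>k x. \<bar>m k x\<bar> \<le> B" "\<And>x. \<bar>m' x\<bar> \<le> B"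
    and lim: "AE x in M. (\<lambda>k. m k x) \<longlonglongrightarrow> m' x"
  shows "L2_tendsto M (\<lambda>k x. m k x *\<^sub>R u k x) (\<lambda>x. m' x *\<^sub>R v x)"
proof (rule L2_tendsto_dominated)
  note u = L2_tendstoD(1)[OF assms(1)] and v = L2_tendstoD(2)[OF assms(1)]
  note [measurable] = square_integrableD(1)[OF v]
  show "square_integrable M (\<lambda>x. m k x *\<^sub>R u k x)" "square_integrable M (\<lambda>x. m' x *\<^sub>R v x)" for k
    by (intro square_integrable_mult_bounded(1)[where B = B] assms(2,3) bound u v)+
  have bound2: "\<bar>m k x - m' x\<bar> \<le> 2 * B" for k x
    using bound(1)[of k x] bound(2)[of x] by linarith
  have near: "square_integrable M (\<lambda>x. m k x *\<^sub>R (u k x - v x))"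
    "sq_norm M (\<lambda>x. m k x *\<^sub>R (u k x - v x)) \<le> B\<^sup>2 * sq_norm M (\<lambda>x. u k x - v x)" for k
    by (intro square_integrable_mult_bounded[where B = B] square_integrable_diff u v bound
        assms(2))+
  have far: "square_integrable M (\<lambda>x. (m k x - m' x) *\<^sub>R v x)" for k
    by (intro square_integrable_mult_bounded(1)[OF _ bound2 v]) measurable
  show "sq_norm M (\<lambda>x. m k x *\<^sub>R u k x - m' x *\<^sub>R v x)
      \<le> 2 * (B\<^sup>2 * sq_norm M (\<lambda>x. u k x - v x)) + 2 * sq_norm M (\<lambda>x. (m k x - m' x) *\<^sub>R v x)" for k
    using sq_norm_add_le[OF near(1)[of k] far[of k]] near(2)[of k] by (simp add: algebra_simps)
  have "(\<lambda>k. sq_norm M (\<lambda>x. (m k x - m' x) *\<^sub>R v x)) \<longlonglongrightarrow> (LINT x|M. 0)"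
    unfolding sq_norm_def
  proof (rule integral_dominated_convergence[where w = "\<lambda>x. (2 * B)\<^sup>2 * (norm (v x))\<^sup>2"])
    show "AE x in M. (\<lambda>k. (norm ((m k x - m' x) *\<^sub>R v x))\<^sup>2) \<longlonglongrightarrow> 0"
      using lim by eventually_elim (auto intro!: tendsto_eq_intros simp: LIM_zero_iff)
    show "AE x in M. norm ((norm ((m k x - m' x) *\<^sub>R v x))\<^sup>2) \<le> (2 * B)\<^sup>2 * (norm (v x))\<^sup>2" for k
      using power_mono[OF bound2, of k _ 2]
      by (intro AE_I2) (simp add: power_mult_distrib mult_right_mono)
  qed (use square_integrableD(2)[OF v] in auto)
  then show "(\<lambda>k. 2 * (B\<^sup>2 * sq_norm M (\<lambda>x. u k x - v x))
      + 2 * sq_norm M (\<lambda>x. (m k x - m' x) *\<^sub>R v x)) \<longlonglongrightarrow> 0"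
    using L2_tendstoD(3)[OF assms(1)] by (auto intro!: tendsto_eq_intros)
qed

subsection \<open>Completeness\<close>

lemma Fatou_integrable:
  fixes u :: "nat \<Rightarrow> 'x \<Rightarrow> real"
  assumes int: "\<And>j. integrable M (u j)" and nonneg: "\<And>j. AE x in M. 0 \<le> u j x"
    and [measurable]: "v \<in> borel_measurable M"
    and lim: "AE x in M. (\<lambda>j. u j x) \<longlonglongrightarrow> v x"
    and bound: "\<And>j. integral\<^sup>L M (u j) \<le> c j" and c: "c \<longlonglongrightarrow> C"
  shows "integrable M v" "integral\<^sup>L M v \<le> C"
proof -
  have [measurable]: "u j \<in> borel_measurable M" for j
    using int by auto
  have "AE x in M. \<forall>j. 0 \<le> u j x"
    using nonneg by (simp add: AE_all_countable)
  then have v_nonneg: "AE x in M. 0 \<le> v x"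
    using lim by eventually_elim (auto intro: LIMSEQ_le_const)
  have "0 \<le> c j" for j
    using bound[of j] integral_nonneg_AE[OF nonneg[of j]] by linarith
  then have "0 \<le> C"
    using c by (auto intro: LIMSEQ_le_const)
  have "(\<integral>\<^sup>+x. ennreal (v x) \<partial>M) = (\<integral>\<^sup>+x. liminf (\<lambda>j. ennreal (u j x)) \<partial>M)"
    using lim
    by (intro nn_integral_cong_AE, eventually_elim)
       (metis lim_imp_Liminf tendsto_ennrealI trivial_limit_sequentially)
  also have "\<dots> \<le> liminf (\<lambda>j. \<integral>\<^sup>+x. ennreal (u j x) \<partial>M)"
    by (rule nn_integral_liminf) simp
  also have "\<dots> \<le> liminf (\<lambda>j. ennreal (c j))"
    using bound by (intro Liminf_mono always_eventually allI)
      (simp add: nn_integral_eq_integral[OF int nonneg] ennreal_leI)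
  also have "\<dots> = ennreal C"
    using c by (intro lim_imp_Liminf tendsto_ennrealI) auto
  finally have le: "(\<integral>\<^sup>+x. ennreal (v x) \<partial>M) \<le> ennreal C" .
  show integrable: "integrable M v"
    using le v_nonneg by (intro integrableI_nonneg) (auto simp: order.strict_iff_order top_unique)
  show "integral\<^sup>L M v \<le> C"
    using le \<open>0 \<le> C\<close> by (simp add: nn_integral_eq_integral[OF integrable v_nonneg])
qed

lemma sq_norm_diff_AE_limit_le:
  assumes u: "square_integrable M u" and w: "\<And>j::nat. square_integrable M (w j)"
    and [measurable]: "v \<in> borel_measurable M"
    and lim: "AE x in M. (\<lambda>j. w j x) \<longlonglongrightarrow> v x" and le: "\<And>j. sq_norm M (\<lambda>x. u x - w j x) \<le> e"
  shows "square_integrable M (\<lambda>x. u x - v x)" "sq_norm M (\<lambda>x. u x - v x) \<le> e"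
proof -
  note [measurable] = square_integrableD(1)[OF u]
  have "AE x in M. (\<lambda>j. (norm (u x - w j x))\<^sup>2) \<longlonglongrightarrow> (norm (u x - v x))\<^sup>2"
    using lim by eventually_elim (intro tendsto_intros)
  note Fatou = Fatou_integrable[OF square_integrableD(2)[OF square_integrable_diff[OF u w]] _ _ this
      le[unfolded sq_norm_def] tendsto_const]
  show "square_integrable M (\<lambda>x. u x - v x)" "sq_norm M (\<lambda>x. u x - v x) \<le> e"
    using Fatou by (simp_all add: square_integrable_def sq_norm_def)
qed

lemma AE_summable_of_summable_integral:
  fixes u :: "nat \<Rightarrow> 'x \<Rightarrow> real"
  assumes int: "\<And>n. integrable M (u n)" and nonneg: "\<And>n x. 0 \<le> u n x"
    and summable: "summable (\<lambda>n. LINT x|M. u n x)"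
  shows "AE x in M. summable (\<lambda>n. u n x)"
proof -
  have [measurable]: "u n \<in> borel_measurable M" for n
    using int by auto
  have "(\<integral>\<^sup>+x. (\<Sum>n. ennreal (u n x)) \<partial>M) = (\<Sum>n. \<integral>\<^sup>+x. ennreal (u n x) \<partial>M)"
    by (rule nn_integral_suminf) simp
  also have "\<dots> = (\<Sum>n. ennreal (LINT x|M. u n x))"
    using nonneg by (simp add: nn_integral_eq_integral[OF int])
  also have "\<dots> = ennreal (\<Sum>n. LINT x|M. u n x)"
    using nonneg by (intro suminf_ennreal2 summable) (simp add: integral_nonneg_AE)
  finally have "AE x in M. (\<Sum>n. ennreal (u n x)) \<noteq> \<infinity>"
    by (intro nn_integral_noteq_infinite) auto
  then show ?thesis
    by eventually_elim (rule summable_suminf_not_top, auto simp: nonneg)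
qed

lemma summable_norm_of_summable_weighted_squares:
  fixes d :: "nat \<Rightarrow> 'b::real_normed_vector"
  assumes "summable (\<lambda>n. 2 ^ n * (norm (d n))\<^sup>2)"
  shows "summable (\<lambda>n. norm (d n))"
proof (rule summable_comparison_test_ev)
  show "summable (\<lambda>n. 2 ^ n * (norm (d n))\<^sup>2 + (1/2) ^ n)"
    by (intro summable_add assms summable_geometric) simp
  have "norm (d n) \<le> 2 ^ n * (norm (d n))\<^sup>2 + (1/2) ^ n" for n
  proof -
    have "0 \<le> 2 ^ n * (norm (d n) - (1/2) ^ n)\<^sup>2" by simp
    also have "\<dots> = 2 ^ n * (norm (d n))\<^sup>2 - 2 * norm (d n) * (2 * (1/2)) ^ n
        + (1/2) ^ n * (2 * (1/2)) ^ n"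
      unfolding power_mult_distrib by (simp add: power2_eq_square algebra_simps)
    finally have "2 * norm (d n) \<le> 2 ^ n * (norm (d n))\<^sup>2 + (1/2) ^ n" by simp
    then show ?thesis using norm_ge_zero[of "d n"] by linarith
  qed
  then show "\<forall>\<^sub>F n in sequentially. norm (norm (d n)) \<le> 2 ^ n * (norm (d n))\<^sup>2 + (1/2) ^ n"
    by simp
qed

lemma L2_geometric_increments_AE_convergent:
  assumes u: "\<And>n. square_integrable M (u n)"
    and increments: "\<And>n. sq_norm M (\<lambda>x. u (Suc n) x - u n x) \<le> (1/8) ^ n"
  shows "AE x in M. convergent (\<lambda>n. u n x)"
proof -
  define d where "d n x = u (Suc n) x - u n x" for n x
  have "AE x in M. summable (\<lambda>n. 2 ^ n * (norm (d n x))\<^sup>2)"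
  proof (rule AE_summable_of_summable_integral)
    show "integrable M (\<lambda>x. 2 ^ n * (norm (d n x))\<^sup>2)" for n
      using square_integrableD(2)[OF square_integrable_diff[OF u u]] by (simp add: d_def)
    have "(LINT x|M. 2 ^ n * (norm (d n x))\<^sup>2) \<le> (1/4) ^ n" for n
    proof -
      have "(LINT x|M. 2 ^ n * (norm (d n x))\<^sup>2) = 2 ^ n * sq_norm M (\<lambda>x. u (Suc n) x - u n x)"
        by (simp add: sq_norm_def d_def)
      also have "\<dots> \<le> 2 ^ n * (1/8) ^ n"
        using increments by (intro mult_left_mono) auto
      also have "\<dots> = (1/4) ^ n"
        by (simp flip: power_mult_distrib)
      finally show ?thesis .
    qed
    then show "summable (\<lambda>n. LINT x|M. 2 ^ n * (norm (d n x))\<^sup>2)"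
      by (intro summable_comparison_test'[OF summable_geometric[of "1/4"], of 0]) simp_all
  qed simp
  then show ?thesis
  proof eventually_elim
    case (elim x)
    then have "summable (\<lambda>n. d n x)"
      by (rule summable_norm_cancel[OF summable_norm_of_summable_weighted_squares])
    then have "convergent (\<lambda>n. (\<Sum>i<n. d i x) + u 0 x)"
      by (intro convergent_add convergent_const) (simp add: summable_iff_convergent)
    moreover have "(\<Sum>i<n. d i x) + u 0 x = u n x" for n
      using sum_lessThan_telescope[of "\<lambda>i. u i x" n] by (simp add: d_def)
    ultimately show ?case by simp
  qed
qed

lemma L2_Cauchy_geometric_subseq:
  assumes "L2_Cauchy M u"
  obtains r where "strict_mono r"
    "\<And>n. sq_norm M (\<lambda>x. u (r (Suc n)) x - u (r n) x) \<le> (1/8) ^ n"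
proof -
  have "\<exists>N. \<forall>j\<ge>N. \<forall>k\<ge>N. sq_norm M (\<lambda>x. u j x - u k x) < (1/8) ^ n" for n :: nat
    using assms by (simp add: L2_Cauchy_def)
  then obtain N where N: "\<And>n j k. N n \<le> j \<Longrightarrow> N n \<le> k \<Longrightarrow> sq_norm M (\<lambda>x. u j x - u k x) < (1/8) ^ n"
    by metis
  define r where "r n = (\<Sum>i\<le>n. Suc (N i))" for n
  have "strict_mono r"
    by (auto simp: strict_mono_Suc_iff r_def)
  have "N n \<le> r n" for n
    by (cases n) (simp_all add: r_def)
  then have "sq_norm M (\<lambda>x. u (r (Suc n)) x - u (r n) x) \<le> (1/8) ^ n" for n
    using strict_monoD[OF \<open>strict_mono r\<close>, of n "Suc n"]
    by (intro less_imp_le[OF N]) (auto intro: order_trans less_imp_le)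
  then show thesis
    using \<open>strict_mono r\<close> that by blast
qed

lemma L2_Cauchy_tendsto_AE_limit:
  assumes Cauchy: "L2_Cauchy M u" and "strict_mono r"
    and [measurable]: "v \<in> borel_measurable M" and lim: "AE x in M. (\<lambda>n. u (r n) x) \<longlonglongrightarrow> v x"
  shows "L2_tendsto M u v"
proof -
  have u: "square_integrable M (u k)" for k
    using Cauchy by (simp add: L2_Cauchy_def)
  have close: "\<exists>N. \<forall>k\<ge>N. square_integrable M (\<lambda>x. u k x - v x) \<and> sq_norm M (\<lambda>x. u k x - v x) \<le> e"
    if "0 < e" for e
  proof -
    obtain N where N: "\<And>j k. N \<le> j \<Longrightarrow> N \<le> k \<Longrightarrow> sq_norm M (\<lambda>x. u j x - u k x) < e"
      using Cauchy \<open>0 < e\<close> unfolding L2_Cauchy_def by meson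
    have "N \<le> r (j + N)" for j
      using seq_suble[OF \<open>strict_mono r\<close>, of "j + N"] by simp
    then have tail_le: "sq_norm M (\<lambda>x. u k x - u (r (j + N)) x) \<le> e" if "N \<le> k" for j k
      by (intro less_imp_le[OF N] that)
    have tail_lim: "AE x in M. (\<lambda>j. u (r (j + N)) x) \<longlonglongrightarrow> v x"
      using lim by eventually_elim (rule LIMSEQ_ignore_initial_segment)
    show ?thesis
      using sq_norm_diff_AE_limit_le[OF u u assms(3) tail_lim tail_le] by blast
  qed
  obtain k where "square_integrable M (\<lambda>x. u k x - v x)"
    using close[of 1] by auto
  then have "square_integrable M v"
    using square_integrable_diff[OF u[of k]] by fastforce
  moreover have "(\<lambda>k. sq_norm M (\<lambda>x. u k x - v x)) \<longlonglongrightarrow> 0"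
  proof (rule LIMSEQ_I)
    fix e :: real assume "0 < e"
    then show "\<exists>N. \<forall>k\<ge>N. norm (sq_norm M (\<lambda>x. u k x - v x) - 0) < e"
      using close[of "e / 2"] by fastforce
  qed
  ultimately show ?thesis
    using u by (simp add: L2_tendsto_def)
qed

theorem L2_complete:
  fixes u :: "nat \<Rightarrow> 'x \<Rightarrow> 'b::euclidean_space"
  assumes Cauchy: "L2_Cauchy M u"
  obtains v where "L2_tendsto M u v"
proof -
  have u: "square_integrable M (u k)" for k
    using Cauchy by (simp add: L2_Cauchy_def)
  note [measurable] = square_integrableD(1)[OF u]
  obtain r where r: "strict_mono r"
    "\<And>n. sq_norm M (\<lambda>x. u (r (Suc n)) x - u (r n) x) \<le> (1/8) ^ n"
    using L2_Cauchy_geometric_subseq[OF Cauchy] by blast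
  define v where "v x = lim (\<lambda>n. u (r n) x)" for x
  have "v \<in> borel_measurable M"
    unfolding v_def by (intro borel_measurable_lim_metric) simp
  moreover have "AE x in M. (\<lambda>n. u (r n) x) \<longlonglongrightarrow> v x"
    using L2_geometric_increments_AE_convergent[OF u r(2)]
    by (simp add: v_def convergent_LIMSEQ_iff)
  ultimately show thesis
    by (rule that[OF L2_Cauchy_tendsto_AE_limit[OF Cauchy r(1)]])
qed

section \<open>Test functions\<close>

locale open_domain =
  fixes \<Omega> :: "'a::euclidean_space set"
  assumes open_domain: "open \<Omega>"
begin

abbreviation \<mu> :: "'a measure" where
  "\<mu> \<equiv> lebesgue_on \<Omega>"

lemma lebesgue_measurable_domain [simp]: "\<Omega> \<in> sets lebesgue"
  using open_domain by auto

end

locale bounded_open_domain = open_domain +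
  assumes bounded_domain: "bounded \<Omega>"

sublocale bounded_open_domain \<subseteq> finite_measure \<mu>
  using open_domain bounded_domain by (intro finite_measure_lebesgue_on lmeasurable_open)

lemma C1c_testD:
  assumes "C1c_test \<Omega> \<phi> D"
  shows "(\<phi> has_derivative (\<lambda>y. D x \<bullet> y)) (at x)" "continuous_on UNIV D"
    "compact (closure {x. \<phi> x \<noteq> 0})" "closure {x. \<phi> x \<noteq> 0} \<subseteq> \<Omega>" "continuous_on UNIV \<phi>"
proof -
  show deriv: "(\<phi> has_derivative (\<lambda>y. D x \<bullet> y)) (at x)" for x
    using assms by (simp add: C1c_test_def)
  show "continuous_on UNIV \<phi>"
    using has_derivative_continuous[OF deriv] by (simp add: continuous_on_eq_continuous_at)
qed (use assms in \<open>simp_all add: C1c_test_def\<close>)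

lemma C1c_testI:
  assumes "\<And>x. (\<phi> has_derivative (\<lambda>y. D x \<bullet> y)) (at x)" "continuous_on UNIV D"
    and "compact K" "K \<subseteq> \<Omega>" "\<And>x. x \<notin> K \<Longrightarrow> \<phi> x = 0"
  shows "C1c_test \<Omega> \<phi> D"
proof -
  have sub: "closure {x. \<phi> x \<noteq> 0} \<subseteq> K"
    using assms(3,5) by (intro closure_minimal compact_imp_closed) auto
  then have "compact (closure {x. \<phi> x \<noteq> 0})"
    using assms(3) by (meson bounded_subset closed_closure compact_eq_bounded_closed)
  then show ?thesis using assms sub by (auto simp: C1c_test_def)
qed

lemma C1c_test_zero_outside:
  assumes "C1c_test \<Omega> \<phi> D" "x \<notin> closure {x. \<phi> x \<noteq> 0}"
  shows "\<phi> x = 0" "D x = 0"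
proof -
  let ?U = "- closure {x. \<phi> x \<noteq> 0}"
  have zero: "\<phi> y = 0" if "y \<in> ?U" for y
    using that closure_subset[of "{x. \<phi> x \<noteq> 0}"] by auto
  show "\<phi> x = 0" using zero[of x] assms(2) by simp
  have "(\<phi> has_derivative (\<lambda>y. 0)) (at x)"
  proof (rule has_derivative_transform_within_open[of "\<lambda>_. 0" _ _ _ ?U])
    show "0 = \<phi> y" if "y \<in> ?U" for y using zero[OF that] by simp
  qed (use assms(2) in \<open>simp_all add: open_Compl\<close>)
  then have "(\<lambda>y. D x \<bullet> y) = (\<lambda>y. 0)"
    using C1c_testD(1)[OF assms(1)] by (rule has_derivative_unique[symmetric])
  then show "D x = 0" by (metis inner_eq_zero_iff)
qed

lemma C1c_test_zero_outside_domain: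
  assumes "C1c_test \<Omega> \<phi> D" "x \<notin> \<Omega>"
  shows "\<phi> x = 0" "D x = 0"
  using C1c_test_zero_outside[OF assms(1), of x] C1c_testD(4)[OF assms(1)] assms(2) by auto

lemma C1c_test_bounded:
  assumes "C1c_test \<Omega> \<phi> D"
  obtains B where "\<And>x. \<bar>\<phi> x\<bar> \<le> B"
proof -
  let ?K = "closure {x. \<phi> x \<noteq> 0}"
  have "bounded (\<phi> ` ?K)"
    using C1c_testD[OF assms]
    by (intro compact_imp_bounded compact_continuous_image) (auto intro: continuous_on_subset)
  then obtain B where "\<And>x. x \<in> ?K \<Longrightarrow> \<bar>\<phi> x\<bar> \<le> B"
    by (auto simp: bounded_iff)
  moreover have "\<bar>\<phi> x\<bar> \<le> 0" if "x \<notin> ?K" for x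
    using C1c_test_zero_outside(1)[OF assms that] by simp
  ultimately show thesis
    using that[of "max 0 B"] by (meson le_max_iff_disj)
qed

lemma C1c_test_borel_measurable:
  assumes "C1c_test \<Omega> \<phi> D"
  shows "\<phi> \<in> borel_measurable borel" "D \<in> borel_measurable borel"
  using C1c_testD(2,5)[OF assms] by (auto intro: borel_measurable_continuous_onI)

lemma borel_measurable_lebesgue_on:
  "u \<in> borel_measurable borel \<Longrightarrow> u \<in> borel_measurable (lebesgue_on S)"
  by (intro measurable_restrict_space1 measurable_completion) simp

lemma C1c_test_measurable:
  assumes "C1c_test \<Omega> \<phi> D"
  shows "\<phi> \<in> borel_measurable (lebesgue_on S)" "D \<in> borel_measurable (lebesgue_on S)"
  using C1c_test_borel_measurable[OF assms] by (auto intro: borel_measurable_lebesgue_on)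

lemma C1c_test_add_scaleR:
  assumes \<phi>: "C1c_test \<Omega> \<phi> D" and \<psi>: "C1c_test \<Omega> \<psi> E"
  shows "C1c_test \<Omega> (\<lambda>x. a * \<phi> x + b * \<psi> x) (\<lambda>x. a *\<^sub>R D x + b *\<^sub>R E x)"
proof (rule C1c_testI)
  let ?K = "closure {x. \<phi> x \<noteq> 0} \<union> closure {x. \<psi> x \<noteq> 0}"
  show "((\<lambda>x. a * \<phi> x + b * \<psi> x) has_derivative (\<lambda>y. (a *\<^sub>R D x + b *\<^sub>R E x) \<bullet> y)) (at x)" for x
    by (auto intro!: derivative_eq_intros C1c_testD(1)[OF \<phi>] C1c_testD(1)[OF \<psi>]
        simp: inner_add_left)
  show "continuous_on UNIV (\<lambda>x. a *\<^sub>R D x + b *\<^sub>R E x)"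
    by (intro continuous_intros C1c_testD(2)[OF \<phi>] C1c_testD(2)[OF \<psi>])
  show "compact ?K" "?K \<subseteq> \<Omega>"
    using C1c_testD(3,4)[OF \<phi>] C1c_testD(3,4)[OF \<psi>] by (auto intro: compact_Un)
  show "a * \<phi> x + b * \<psi> x = 0" if "x \<notin> ?K" for x
    using that C1c_test_zero_outside(1)[OF \<phi>, of x] C1c_test_zero_outside(1)[OF \<psi>, of x] by simp
qed

lemma C1c_test_diff:
  assumes "C1c_test \<Omega> \<phi> D" "C1c_test \<Omega> \<psi> E"
  shows "C1c_test \<Omega> (\<lambda>x. \<phi> x - \<psi> x) (\<lambda>x. D x - E x)"
  using C1c_test_add_scaleR[OF assms, of 1 "-1"] by simp

lemma C1c_test_zero: "C1c_test \<Omega> (\<lambda>x. 0) (\<lambda>x. 0)"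
  by (simp add: C1c_test_def)

lemma C1c_test_uminus: "C1c_test \<Omega> \<phi> D \<Longrightarrow> C1c_test \<Omega> (\<lambda>x. - \<phi> x) (\<lambda>x. - D x)"
  using C1c_test_diff[OF C1c_test_zero] by simp

lemma C1c_test_compose:
  assumes \<phi>: "C1c_test \<Omega> \<phi> D" and \<theta>: "\<And>s. (\<theta> has_field_derivative \<theta>' s) (at s)"
    and cont: "continuous_on UNIV \<theta>'" and "\<theta> 0 = 0"
  shows "C1c_test \<Omega> (\<lambda>x. \<theta> (\<phi> x)) (\<lambda>x. \<theta>' (\<phi> x) *\<^sub>R D x)"
proof (rule C1c_testI)
  show "((\<lambda>x. \<theta> (\<phi> x)) has_derivative (\<lambda>y. (\<theta>' (\<phi> x) *\<^sub>R D x) \<bullet> y)) (at x)" for x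
    using has_derivative_compose[OF C1c_testD(1)[OF \<phi>, of x] \<theta>[unfolded has_field_derivative_def]]
    by (simp add: mult.commute)
  show "continuous_on UNIV (\<lambda>x. \<theta>' (\<phi> x) *\<^sub>R D x)"
    using C1c_testD(2,5)[OF \<phi>] by (intro continuous_intros continuous_on_compose2[OF cont]) auto
  show "\<theta> (\<phi> x) = 0" if "x \<notin> closure {x. \<phi> x \<noteq> 0}" for x
    using C1c_test_zero_outside(1)[OF \<phi> that] assms(4) by simp
qed (fact C1c_testD(3,4)[OF \<phi>])+

lemma C1c_test_inner_mult_square:
  assumes \<phi>: "C1c_test \<Omega> \<phi> D"
  shows "C1c_test \<Omega> (\<lambda>x. (x \<bullet> b) * (\<phi> x)\<^sup>2) (\<lambda>x. (\<phi> x)\<^sup>2 *\<^sub>R b + (2 * (x \<bullet> b) * \<phi> x) *\<^sub>R D x)"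
    (is "C1c_test \<Omega> ?\<psi> ?E")
proof (rule C1c_testI[OF _ _ C1c_testD(3,4)[OF \<phi>]])
  show "(?\<psi> has_derivative (\<lambda>y. ?E x \<bullet> y)) (at x)" for x
    by (auto intro!: derivative_eq_intros C1c_testD(1)[OF \<phi>] simp: algebra_simps inner_commute)
  show "continuous_on UNIV ?E"
    by (intro continuous_intros C1c_testD(2,5)[OF \<phi>])
  show "?\<psi> x = 0" if "x \<notin> closure {x. \<phi> x \<noteq> 0}" for x
    using C1c_test_zero_outside(1)[OF \<phi> that] by simp
qed

lemma square_integrable_compact_support:
  fixes u :: "'a::euclidean_space \<Rightarrow> 'b::euclidean_space"
  assumes S: "S \<in> sets lebesgue" and cont: "continuous_on UNIV u"
    and "compact K" and zero: "\<And>x. x \<notin> K \<Longrightarrow> u x = 0"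
  shows "square_integrable (lebesgue_on S) u"
proof -
  have "continuous_on K (\<lambda>x. (norm (u x))\<^sup>2)"
    using cont by (intro continuous_intros) (auto intro: continuous_on_subset)
  then have "integrable lborel (\<lambda>x. indicator K x *\<^sub>R (norm (u x))\<^sup>2)"
    by (rule borel_integrable_compact[OF \<open>compact K\<close>])
  also have "(\<lambda>x. indicator K x *\<^sub>R (norm (u x))\<^sup>2) = (\<lambda>x. (norm (u x))\<^sup>2)"
    using zero by (auto simp: fun_eq_iff indicator_def)
  finally have "integrable lebesgue (\<lambda>x. (norm (u x))\<^sup>2)"
    by (simp add: integrable_completion)
  then have "integrable (lebesgue_on S) (\<lambda>x. (norm (u x))\<^sup>2)"
    using S integrable_mult_indicator[of S lebesgue "\<lambda>x. (norm (u x))\<^sup>2"]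
    by (simp add: integrable_restrict_space)
  moreover have "u \<in> borel_measurable (lebesgue_on S)"
    by (intro borel_measurable_lebesgue_on borel_measurable_continuous_onI cont)
  ultimately show ?thesis by (simp add: square_integrable_def)
qed

lemma (in open_domain) C1c_test_square_integrable:
  assumes "C1c_test \<Omega> \<phi> D"
  shows "square_integrable \<mu> \<phi>" "square_integrable \<mu> D"
  using square_integrable_compact_support[OF lebesgue_measurable_domain C1c_testD(5,3)[OF assms]]
    square_integrable_compact_support[OF lebesgue_measurable_domain C1c_testD(2,3)[OF assms]]
    C1c_test_zero_outside[OF assms] by blast+

subsection \<open>The Poincare inequality\<close>

lemma integral_lborel_translate:
  fixes u :: "'a::euclidean_space \<Rightarrow> real"
  assumes "u \<in> borel_measurable borel"
  shows "(LINT x|lborel. u (x + b)) = (LINT x|lborel. u x)"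
proof -
  have "(LINT x|lborel. u x) = (LINT x|distr lborel borel ((+) b). u x)"
    by (simp add: lborel_distr_plus)
  also have "\<dots> = (LINT x|lborel. u (b + x))"
    using assms by (subst integral_distr) auto
  finally show ?thesis by (simp add: add.commute)
qed

lemma integral_lborel_eq_integral_cbox:
  fixes u :: "'a::euclidean_space \<Rightarrow> real"
  assumes cont: "continuous_on UNIV u" and zero: "\<And>x. x \<notin> cbox a b \<Longrightarrow> u x = 0"
  shows "(LINT x|lborel. u x) = integral (cbox a b) u"
proof -
  have "set_integrable lborel (cbox a b) u"
    unfolding set_integrable_def using cont
    by (intro borel_integrable_compact compact_cbox) (auto intro: continuous_on_subset)
  then have "(LINT x:cbox a b|lborel. u x) = integral (cbox a b) u"
    by (rule set_borel_integral_eq_integral)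
  moreover have "(\<lambda>x. indicator (cbox a b) x *\<^sub>R u x) = u"
    using zero by (auto simp: fun_eq_iff indicator_def)
  ultimately show ?thesis by (simp add: set_lebesgue_integral_def)
qed

lemma C1c_test_translates_zero_outside_cbox:
  fixes b :: "'a::euclidean_space"
  assumes "C1c_test \<Omega> \<phi> D"
  obtains a c where "\<And>x s. x \<notin> cbox a c \<Longrightarrow> s \<in> {-1..1} \<Longrightarrow> \<phi> (x + s *\<^sub>R b) = 0"
    "\<And>x s. x \<notin> cbox a c \<Longrightarrow> s \<in> {-1..1} \<Longrightarrow> D (x + s *\<^sub>R b) = 0"
proof -
  let ?K = "closure {x. \<phi> x \<noteq> 0}" and ?I = "{-1..1::real}"
  have "bounded ((\<lambda>(x, s). x - s *\<^sub>R b) ` (?K \<times> ?I))"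
    by (intro compact_imp_bounded compact_continuous_image compact_Times C1c_testD(3)[OF assms]
        compact_Icc)
       (auto simp: case_prod_unfold intro!: continuous_intros)
  then obtain a c where box: "(\<lambda>(x, s). x - s *\<^sub>R b) ` (?K \<times> ?I) \<subseteq> cbox a c"
    using bounded_subset_cbox_symmetric by blast
  have "x + s *\<^sub>R b \<notin> ?K" if "x \<notin> cbox a c" "s \<in> ?I" for x s
  proof
    assume "x + s *\<^sub>R b \<in> ?K"
    then have "(x + s *\<^sub>R b) - s *\<^sub>R b \<in> cbox a c"
      using box \<open>s \<in> ?I\<close> by blast
    then show False
      using \<open>x \<notin> cbox a c\<close> by simp
  qed
  then show thesis
    using that C1c_test_zero_outside[OF assms] by blast
qed

lemma has_field_derivative_integral_cbox_translate:
  fixes b :: "'a::euclidean_space"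
  assumes deriv: "\<And>x. (\<phi> has_derivative (\<lambda>y. D x \<bullet> y)) (at x)" and D: "continuous_on UNIV D"
  shows "((\<lambda>s. integral (cbox a c) (\<lambda>x. \<phi> (x + s *\<^sub>R b))) has_field_derivative
    integral (cbox a c) (\<lambda>x. D (x + s *\<^sub>R b) \<bullet> b)) (at s)"
proof (rule leibniz_rule_field_derivative)
  fix s :: real and x :: 'a
  have "((\<lambda>s. x + s *\<^sub>R b) has_derivative (\<lambda>t. t *\<^sub>R b)) (at s)"
    by (auto intro!: derivative_eq_intros)
  then have "((\<lambda>s. \<phi> (x + s *\<^sub>R b)) has_derivative (\<lambda>t. D (x + s *\<^sub>R b) \<bullet> (t *\<^sub>R b))) (at s)"
    by (rule has_derivative_compose) (rule deriv)
  then show "((\<lambda>s. \<phi> (x + s *\<^sub>R b)) has_field_derivative D (x + s *\<^sub>R b) \<bullet> b) (at s)"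
    by (simp add: has_field_derivative_def mult.commute[of _ "D _ \<bullet> b"])
next
  have "continuous_on UNIV \<phi>"
    using has_derivative_continuous[OF deriv] by (simp add: continuous_on_eq_continuous_at)
  then show "(\<lambda>x. \<phi> (x + s *\<^sub>R b)) integrable_on cbox a c" for s
    by (intro integrable_continuous) (auto intro!: continuous_intros elim: continuous_on_compose2)
  show "continuous_on (UNIV \<times> cbox a c) (\<lambda>(s, x). D (x + s *\<^sub>R b) \<bullet> b)"
    by (auto simp: case_prod_unfold intro!: continuous_intros continuous_on_compose2[OF D])
qed auto

text \<open>\<open>s \<mapsto> \<integral> \<phi> (x + s b) dx\<close> is constant, and its derivative at \<open>0\<close> is the integral in question.\<close>

lemma integral_directional_derivative_eq_0:
  fixes b :: "'a::euclidean_space"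
  assumes \<phi>: "C1c_test UNIV \<phi> D"
  shows "(LINT x|lborel. D x \<bullet> b) = 0"
proof -
  obtain a c where zero: "\<And>x s. x \<notin> cbox a c \<Longrightarrow> s \<in> {-1..1} \<Longrightarrow> \<phi> (x + s *\<^sub>R b) = 0"
    "\<And>x s. x \<notin> cbox a c \<Longrightarrow> s \<in> {-1..1} \<Longrightarrow> D (x + s *\<^sub>R b) = 0"
    using C1c_test_translates_zero_outside_cbox[OF \<phi>] by blast
  note cont = continuous_on_compose2[OF C1c_testD(5)[OF \<phi>]]
    continuous_on_compose2[OF C1c_testD(2)[OF \<phi>]]
  have const: "integral (cbox a c) (\<lambda>x. \<phi> (x + s *\<^sub>R b)) = (LINT x|lborel. \<phi> x)"
    if "s \<in> {-1<..<1}" for s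
  proof -
    have "integral (cbox a c) (\<lambda>x. \<phi> (x + s *\<^sub>R b)) = (LINT x|lborel. \<phi> (x + s *\<^sub>R b))"
      using zero(1) that
      by (intro integral_lborel_eq_integral_cbox[symmetric]) (auto intro!: continuous_intros cont)
    also have "\<dots> = (LINT x|lborel. \<phi> x)"
      by (rule integral_lborel_translate[OF C1c_test_borel_measurable(1)[OF \<phi>]])
    finally show ?thesis .
  qed
  have "((\<lambda>s. LINT x|lborel. \<phi> x) has_field_derivative
      integral (cbox a c) (\<lambda>x. D (x + 0 *\<^sub>R b) \<bullet> b)) (at 0)"
    by (rule has_field_derivative_transform_within_open[OF
          has_field_derivative_integral_cbox_translate[OF C1c_testD(1,2)[OF \<phi>]], of "{-1<..<1}"])
       (auto simp: const)
  then have "integral (cbox a c) (\<lambda>x. D x \<bullet> b) = 0"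
    using DERIV_unique[OF _ DERIV_const] by simp
  moreover have "(LINT x|lborel. D x \<bullet> b) = integral (cbox a c) (\<lambda>x. D x \<bullet> b)"
    using zero(2)[of _ 0]
    by (intro integral_lborel_eq_integral_cbox) (auto intro!: continuous_intros cont)
  ultimately show ?thesis by simp
qed

lemma integral_lebesgue_on_eq_lborel:
  fixes u :: "'a::euclidean_space \<Rightarrow> real"
  assumes "S \<in> sets lebesgue" "u \<in> borel_measurable borel" "\<And>x. x \<notin> S \<Longrightarrow> u x = 0"
  shows "(LINT x|lebesgue_on S. u x) = (LINT x|lborel. u x)"
proof -
  have "(if x \<in> S then u x else 0) = u x" for x
    using assms(3) by simp
  then show ?thesis
    using assms(2) Lebesgue_Measure.integral_restrict_UNIV[OF assms(1), of u]
    by (simp add: integral_completion)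
qed

context open_domain
begin

lemma C1c_test_integral_gradient_eq_0:
  assumes "C1c_test \<Omega> \<phi> D"
  shows "(LINT x|\<mu>. D x \<bullet> b) = 0"
proof -
  have "(LINT x|\<mu>. D x \<bullet> b) = (LINT x|lborel. D x \<bullet> b)"
    using C1c_test_borel_measurable(2)[OF assms] C1c_test_zero_outside_domain(2)[OF assms]
    by (intro integral_lebesgue_on_eq_lborel) auto
  also have "\<dots> = 0"
    using assms by (intro integral_directional_derivative_eq_0[of \<phi>]) (simp add: C1c_test_def)
  finally show ?thesis .
qed

text \<open>The gradient of \<open>(x \<bullet> b) \<phi>\<^sup>2\<close> integrates to zero in the direction \<open>b\<close>.\<close>

lemma Poincare_inequality:
  assumes b: "norm b = 1" and R: "\<And>x. x \<in> \<Omega> \<Longrightarrow> \<bar>x \<bullet> b\<bar> \<le> R" and \<phi>: "C1c_test \<Omega> \<phi> D"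
  shows "sq_norm \<mu> \<phi> \<le> (2 * R)\<^sup>2 * sq_norm \<mu> D"
proof -
  let ?E = "\<lambda>x. (\<phi> x)\<^sup>2 *\<^sub>R b + (2 * (x \<bullet> b) * \<phi> x) *\<^sub>R D x"
  define V where "V x = 2 * (x \<bullet> b) * (D x \<bullet> b)" for x
  note sq = C1c_test_square_integrable[OF \<phi>]
  have "(LINT x|\<mu>. ?E x \<bullet> b) = 0"
    by (rule C1c_test_integral_gradient_eq_0[OF C1c_test_inner_mult_square[OF \<phi>]])
  moreover have "?E x \<bullet> b = (norm (\<phi> x))\<^sup>2 + \<phi> x \<bullet> V x" for x
    using b by (simp add: V_def inner_add_left norm_eq_1)
  moreover have V: "square_integrable \<mu> V"
  proof (rule square_integrable_compact_support)
    show "continuous_on UNIV V"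
      unfolding V_def by (intro continuous_intros C1c_testD(2)[OF \<phi>])
    show "V x = 0" if "x \<notin> closure {x. \<phi> x \<noteq> 0}" for x
      using C1c_test_zero_outside(2)[OF \<phi> that] by (simp add: V_def)
  qed (simp, fact C1c_testD(3)[OF \<phi>])
  ultimately have "sq_norm \<mu> \<phi> + (LINT x|\<mu>. \<phi> x \<bullet> V x) = 0"
    using sq square_integrable_inner[OF sq(1) V] by (simp add: sq_norm_def square_integrable_def)
  then have "sq_norm \<mu> \<phi> \<le> sq_norm \<mu> V"
    by (intro sq_norm_le_of_le_integral_inner[OF sq(1) V]) linarith
  also have "\<dots> \<le> (2 * R)\<^sup>2 * sq_norm \<mu> D"
  proof (rule sq_norm_mono[OF V sq(2)])
    fix x
    have "\<bar>V x\<bar> \<le> 2 * R * norm (D x)"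
    proof (cases "x \<in> \<Omega>")
      case True
      have "\<bar>D x \<bullet> b\<bar> \<le> norm (D x)"
        using Cauchy_Schwarz_ineq2[of "D x" b] b by simp
      then have "\<bar>x \<bullet> b\<bar> * \<bar>D x \<bullet> b\<bar> \<le> R * norm (D x)"
        using R[OF True] by (intro mult_mono) auto
      then show ?thesis by (simp add: V_def abs_mult)
    next
      case False
      then show ?thesis using C1c_test_zero_outside_domain(2)[OF \<phi>] by (simp add: V_def)
    qed
    then show "(norm (V x))\<^sup>2 \<le> (2 * R)\<^sup>2 * (norm (D x))\<^sup>2"
      using power_mono[of "\<bar>V x\<bar>" "2 * R * norm (D x)" 2] by (simp add: power_mult_distrib)
  qed
  finally show ?thesis .
qed

end

section \<open>The space H10\<close>

context open_domain
begin

lemma H10_iff_L2_tendsto: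
  "H10 \<Omega> v G \<longleftrightarrow> (\<exists>\<phi> D. (\<forall>k. C1c_test \<Omega> (\<phi> k) (D k)) \<and> L2_tendsto \<mu> \<phi> v \<and> L2_tendsto \<mu> D G)"
proof -
  have "L2_on \<Omega> v \<longleftrightarrow> square_integrable \<mu> v" "L2_vec_on \<Omega> G \<longleftrightarrow> square_integrable \<mu> G"
    by (simp_all add: L2_on_def L2_vec_on_def square_integrable_def)
  then show ?thesis
    using C1c_test_square_integrable by (auto simp: H10_def L2_tendsto_def sq_norm_def) blast
qed

lemma H10_square_integrable:
  assumes "H10 \<Omega> v G"
  shows "square_integrable \<mu> v" "square_integrable \<mu> G"
  using assms by (auto simp: H10_iff_L2_tendsto L2_tendsto_def)

lemma H10_measurable:
  assumes "H10 \<Omega> v G"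
  shows "v \<in> borel_measurable \<mu>" "G \<in> borel_measurable \<mu>"
  using H10_square_integrable[OF assms] by (auto dest: square_integrableD)

lemma H10_of_C1c_test: "C1c_test \<Omega> \<phi> D \<Longrightarrow> H10 \<Omega> \<phi> D"
  unfolding H10_iff_L2_tendsto
  by (rule exI[of _ "\<lambda>_. \<phi>"], rule exI[of _ "\<lambda>_. D"])
     (simp add: L2_tendsto_const C1c_test_square_integrable)

lemma H10_approximation:
  assumes "H10 \<Omega> v G"
  obtains \<phi> D where "\<And>k. C1c_test \<Omega> (\<phi> k) (D k)" "L2_tendsto \<mu> \<phi> v" "L2_tendsto \<mu> D G"
    "AE x in \<mu>. (\<lambda>k. \<phi> k x) \<longlonglongrightarrow> v x"
proof -
  obtain \<phi> D where test: "\<And>k. C1c_test \<Omega> (\<phi> k) (D k)" and lim: "L2_tendsto \<mu> \<phi> v" "L2_tendsto \<mu> D G"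
    using assms by (auto simp: H10_iff_L2_tendsto)
  obtain r where "strict_mono r" "AE x in \<mu>. (\<lambda>k. \<phi> (r k) x) \<longlonglongrightarrow> v x"
    using L2_tendsto_AE_subseq[OF lim(1)] .
  then show thesis
    using that[of "\<lambda>k. \<phi> (r k)" "\<lambda>k. D (r k)"] test
      L2_tendsto_subseq[OF lim(1)] L2_tendsto_subseq[OF lim(2)]
    by blast
qed

lemma H10_diff:
  assumes "H10 \<Omega> v G" "H10 \<Omega> w W"
  shows "H10 \<Omega> (\<lambda>x. v x - w x) (\<lambda>x. G x - W x)"
proof -
  obtain \<phi> D where "\<And>k. C1c_test \<Omega> (\<phi> k) (D k)" "L2_tendsto \<mu> \<phi> v" "L2_tendsto \<mu> D G"
    using assms(1) by (auto simp: H10_iff_L2_tendsto)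
  moreover obtain \<psi> E where "\<And>k. C1c_test \<Omega> (\<psi> k) (E k)" "L2_tendsto \<mu> \<psi> w" "L2_tendsto \<mu> E W"
    using assms(2) by (auto simp: H10_iff_L2_tendsto)
  ultimately show ?thesis
    unfolding H10_iff_L2_tendsto
    by (intro exI[of _ "\<lambda>k x. \<phi> k x - \<psi> k x"] exI[of _ "\<lambda>k x. D k x - E k x"])
       (auto intro: C1c_test_diff L2_tendsto_diff)
qed

lemma H10_compose:
  assumes "H10 \<Omega> v G"
    and \<theta>: "\<And>s. (\<theta> has_field_derivative \<theta>' s) (at s)" "continuous_on UNIV \<theta>'" "\<theta> 0 = 0"
    and bound: "\<And>s. \<bar>\<theta>' s\<bar> \<le> B"
  shows "H10 \<Omega> (\<lambda>x. \<theta> (v x)) (\<lambda>x. \<theta>' (v x) *\<^sub>R G x)"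
proof -
  obtain \<phi> D where test: "\<And>k. C1c_test \<Omega> (\<phi> k) (D k)"
    and lim: "L2_tendsto \<mu> \<phi> v" "L2_tendsto \<mu> D G" "AE x in \<mu>. (\<lambda>k. \<phi> k x) \<longlonglongrightarrow> v x"
    using H10_approximation[OF assms(1)] by blast
  have [measurable]: "\<theta>' \<in> borel_measurable borel"
    by (rule borel_measurable_continuous_onI[OF \<theta>(2)])
  note [measurable] = H10_measurable[OF assms(1)] C1c_test_measurable[OF test]
  have "\<bar>\<theta> s - \<theta> s'\<bar> \<le> B * \<bar>s - s'\<bar>" for s s'
    using field_differentiable_bound[of UNIV \<theta> \<theta>' B s s'] bound \<theta>(1)
    by (auto intro: has_field_derivative_at_within)
  moreover have "0 \<le> B"
    by (rule order_trans[OF abs_ge_zero bound[of 0]])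
  ultimately have lip: "B-lipschitz_on UNIV \<theta>"
    by (intro lipschitz_onI) (simp_all add: dist_real_def)
  have "L2_tendsto \<mu> (\<lambda>k x. \<theta> (\<phi> k x)) (\<lambda>x. \<theta> (v x))"
    by (rule L2_tendsto_compose_lipschitz[OF lim(1) lip \<theta>(3)])
  moreover have "L2_tendsto \<mu> (\<lambda>k x. \<theta>' (\<phi> k x) *\<^sub>R D k x) (\<lambda>x. \<theta>' (v x) *\<^sub>R G x)"
  proof (rule L2_tendsto_mult_bounded[OF lim(2) _ _ bound bound])
    show "AE x in \<mu>. (\<lambda>k. \<theta>' (\<phi> k x)) \<longlonglongrightarrow> \<theta>' (v x)"
      using lim(3) by eventually_elim (auto intro: continuous_on_tendsto_compose[OF \<theta>(2)])
  qed measurable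
  ultimately show ?thesis
    unfolding H10_iff_L2_tendsto
    by (intro exI[of _ "\<lambda>k x. \<theta> (\<phi> k x)"] exI[of _ "\<lambda>k x. \<theta>' (\<phi> k x) *\<^sub>R D k x"])
       (simp add: C1c_test_compose[OF test \<theta>])
qed

end

context bounded_open_domain
begin

lemma Poincare_constant:
  obtains K where "0 < K" "\<And>\<phi> D. C1c_test \<Omega> \<phi> D \<Longrightarrow> sq_norm \<mu> \<phi> \<le> K * sq_norm \<mu> D"
proof -
  obtain b :: 'a where b: "b \<in> Basis"
    using nonempty_Basis by blast
  obtain R where "0 < R" "\<And>x. x \<in> \<Omega> \<Longrightarrow> norm x \<le> R"
    using bounded_domain by (auto simp: bounded_pos)
  then have "\<bar>x \<bullet> b\<bar> \<le> R" if "x \<in> \<Omega>" for x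
    using Basis_le_norm[OF b, of x] that by (meson order_trans)
  then show thesis
    using Poincare_inequality[of b R] b \<open>0 < R\<close> by (intro that[of "(2 * R)\<^sup>2"]) auto
qed

lemma H10_Poincare_inequality:
  obtains K where "0 < K" "\<And>v G. H10 \<Omega> v G \<Longrightarrow> sq_norm \<mu> v \<le> K * sq_norm \<mu> G"
proof -
  obtain K where "0 < K" and K: "\<And>\<phi> D. C1c_test \<Omega> \<phi> D \<Longrightarrow> sq_norm \<mu> \<phi> \<le> K * sq_norm \<mu> D"
    using Poincare_constant by blast
  have "sq_norm \<mu> v \<le> K * sq_norm \<mu> G" if H: "H10 \<Omega> v G" for v G
  proof -
    obtain \<phi> D where test: "\<And>k. C1c_test \<Omega> (\<phi> k) (D k)"
      and lim: "L2_tendsto \<mu> \<phi> v" "L2_tendsto \<mu> D G"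
      using H by (auto simp: H10_iff_L2_tendsto)
    show ?thesis
      by (rule LIMSEQ_le[OF L2_tendsto_sq_norm[OF lim(1)]
            tendsto_mult_left[OF L2_tendsto_sq_norm[OF lim(2)]]])
         (use K[OF test] in auto)
  qed
  then show thesis using \<open>0 < K\<close> that by blast
qed

lemma H10_zero_gradient:
  assumes "H10 \<Omega> v G" "AE x in \<mu>. G x = 0"
  shows "AE x in \<mu>. v x = 0"
proof -
  obtain K where "sq_norm \<mu> v \<le> K * sq_norm \<mu> G"
    using H10_Poincare_inequality assms(1) by metis
  moreover have "sq_norm \<mu> G = 0"
    using assms(2) sq_norm_eq_0_iff_AE[OF H10_square_integrable(2)[OF assms(1)]] by simp
  ultimately have "sq_norm \<mu> v = 0"
    using sq_norm_nonneg[of \<mu> v] by simp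
  then show ?thesis
    using sq_norm_eq_0_iff_AE[OF H10_square_integrable(1)[OF assms(1)]] by simp
qed

lemma H10_limit_of_Cauchy_gradients:
  assumes test: "\<And>k. C1c_test \<Omega> (\<phi> k) (D k)" and Cauchy: "L2_Cauchy \<mu> D"
  obtains v G where "L2_tendsto \<mu> \<phi> v" "L2_tendsto \<mu> D G"
proof -
  obtain K where "0 < K" and K: "\<And>\<phi> D. C1c_test \<Omega> \<phi> D \<Longrightarrow> sq_norm \<mu> \<phi> \<le> K * sq_norm \<mu> D"
    using Poincare_constant by blast
  have "\<exists>N. \<forall>j\<ge>N. \<forall>k\<ge>N. sq_norm \<mu> (\<lambda>x. \<phi> j x - \<phi> k x) < e" if "0 < e" for e
  proof -
    obtain N where N: "\<And>j k. N \<le> j \<Longrightarrow> N \<le> k \<Longrightarrow> sq_norm \<mu> (\<lambda>x. D j x - D k x) < e / K"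
      using Cauchy \<open>0 < e\<close> \<open>0 < K\<close> unfolding L2_Cauchy_def by (meson divide_pos_pos)
    have "sq_norm \<mu> (\<lambda>x. \<phi> j x - \<phi> k x) < e" if "N \<le> j" "N \<le> k" for j k
      using K[OF C1c_test_diff[OF test test], of j k] N[OF that] \<open>0 < K\<close> by (simp add: field_simps)
    then show ?thesis by blast
  qed
  then have "L2_Cauchy \<mu> \<phi>"
    using C1c_test_square_integrable(1)[OF test] by (simp add: L2_Cauchy_def)
  then show thesis
    using that L2_complete Cauchy by metis
qed

end

section \<open>Weak solutions of the Poisson equation\<close>

text \<open>\<open>- \<Delta> v = u\<close> in \<open>\<Omega>\<close> with zero boundary values, where \<open>G\<close> is the gradient of \<open>v\<close>.\<close>

definition weak_solution ::
    "'a::euclidean_space set \<Rightarrow> ('a \<Rightarrow> real) \<Rightarrow> ('a \<Rightarrow> real) \<Rightarrow> ('a \<Rightarrow> 'a) \<Rightarrow> bool" where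
  "weak_solution \<Omega> u v G \<longleftrightarrow> H10 \<Omega> v G \<and>
     (\<forall>\<phi> D. H10 \<Omega> \<phi> D \<longrightarrow> integrable (lebesgue_on \<Omega>) (\<lambda>x. u x * \<phi> x) \<and>
       (LINT x|lebesgue_on \<Omega>. G x \<bullet> D x) = (LINT x|lebesgue_on \<Omega>. u x * \<phi> x))"

lemma weak_solutionD:
  assumes "weak_solution \<Omega> u v G"
  shows "H10 \<Omega> v G"
    and "H10 \<Omega> \<phi> D \<Longrightarrow> integrable (lebesgue_on \<Omega>) (\<lambda>x. u x * \<phi> x)"
    and "H10 \<Omega> \<phi> D \<Longrightarrow> (LINT x|lebesgue_on \<Omega>. G x \<bullet> D x) = (LINT x|lebesgue_on \<Omega>. u x * \<phi> x)"
  using assms by (auto simp: weak_solution_def)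

subsection \<open>A continuously differentiable positive part\<close>

definition soft_pos :: "real \<Rightarrow> real \<Rightarrow> real" where
  "soft_pos \<epsilon> s = sqrt (\<epsilon>\<^sup>2 + (max 0 s)\<^sup>2) - \<epsilon>"

definition soft_pos' :: "real \<Rightarrow> real \<Rightarrow> real" where
  "soft_pos' \<epsilon> s = max 0 s / sqrt (\<epsilon>\<^sup>2 + (max 0 s)\<^sup>2)"

lemma has_field_derivative_max_0_square:
  "((\<lambda>s. (max 0 s)\<^sup>2) has_field_derivative 2 * max 0 s) (at (s::real))"
proof -
  consider (pos) "s > 0" | (neg) "s < 0" | (zero) "s = 0" by linarith
  then show ?thesis
  proof cases
    case pos
    then have "((\<lambda>s. s\<^sup>2) has_field_derivative 2 * max 0 s) (at s)"
      by (auto intro!: derivative_eq_intros)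
    then show ?thesis
      by (rule has_field_derivative_transform_within_open[where S = "{0<..}"]) (use pos in auto)
  next
    case neg
    then have "((\<lambda>s. 0) has_field_derivative 2 * max 0 s) (at s)" by simp
    then show ?thesis
      by (rule has_field_derivative_transform_within_open[where S = "{..<0}"]) (use neg in auto)
  next
    case zero
    have "((\<lambda>y. (max 0 y)\<^sup>2 / y) \<longlongrightarrow> 0) (at (0::real))"
    proof (rule Lim_null_comparison[OF always_eventually])
      show "\<forall>y::real. norm ((max 0 y)\<^sup>2 / y) \<le> \<bar>y\<bar>" by (auto simp: max_def power2_eq_square)
      show "((\<lambda>y::real. \<bar>y\<bar>) \<longlongrightarrow> 0) (at 0)" by (auto intro!: tendsto_eq_intros)
    qed
    then show ?thesis using zero by (simp add: has_field_derivative_iff)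
  qed
qed

context
  fixes \<epsilon> :: real
  assumes \<epsilon>: "0 < \<epsilon>"
begin

lemma soft_pos_radicand_pos: "0 < \<epsilon>\<^sup>2 + (max 0 s)\<^sup>2"
  using \<epsilon> by (simp add: add_pos_nonneg)

lemma has_field_derivative_soft_pos: "(soft_pos \<epsilon> has_field_derivative soft_pos' \<epsilon> s) (at s)"
proof -
  have "((\<lambda>s. \<epsilon>\<^sup>2 + (max 0 s)\<^sup>2) has_field_derivative 0 + 2 * max 0 s) (at s)"
    by (intro DERIV_add DERIV_const has_field_derivative_max_0_square)
  from DERIV_diff[OF DERIV_chain2[OF DERIV_real_sqrt[OF soft_pos_radicand_pos] this]
      DERIV_const[of \<epsilon>]]
  show ?thesis
    by (simp add: soft_pos_def[abs_def] soft_pos'_def field_simps)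
qed

lemma continuous_on_soft_pos': "continuous_on UNIV (soft_pos' \<epsilon>)"
  unfolding soft_pos'_def[abs_def]
  using soft_pos_radicand_pos
  by (intro continuous_intros) (metis less_irrefl real_sqrt_eq_zero_cancel_iff)

lemma soft_pos'_bounds: "0 \<le> soft_pos' \<epsilon> s" "\<bar>soft_pos' \<epsilon> s\<bar> \<le> 1"
proof -
  have "max 0 s \<le> sqrt (\<epsilon>\<^sup>2 + (max 0 s)\<^sup>2)"
    by (rule real_le_rsqrt) simp
  then show "0 \<le> soft_pos' \<epsilon> s" "\<bar>soft_pos' \<epsilon> s\<bar> \<le> 1"
    using soft_pos_radicand_pos[of s] by (auto simp: soft_pos'_def)
qed

lemma soft_pos_eq_0_iff: "soft_pos \<epsilon> s = 0 \<longleftrightarrow> s \<le> 0"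
proof -
  have "soft_pos \<epsilon> s = 0 \<longleftrightarrow> sqrt (\<epsilon>\<^sup>2 + (max 0 s)\<^sup>2) = sqrt (\<epsilon>\<^sup>2)"
    using \<epsilon> by (simp add: soft_pos_def)
  then show ?thesis
    unfolding real_sqrt_eq_iff by auto
qed

lemma soft_pos_nonneg: "0 \<le> soft_pos \<epsilon> s"
  using \<epsilon> by (simp add: soft_pos_def real_le_rsqrt)

lemma soft_pos_ge: "max 0 s - \<epsilon> \<le> soft_pos \<epsilon> s"
  by (simp add: soft_pos_def real_le_rsqrt)

end

subsection \<open>From test functions to H10\<close>

lemma integrable_mult_bounded:
  fixes f w :: "'x \<Rightarrow> real"
  assumes "integrable M f" "w \<in> borel_measurable M" "AE x in M. \<bar>w x\<bar> \<le> B"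
  shows "integrable M (\<lambda>x. f x * w x)"
proof (rule Bochner_Integration.integrable_bound)
  show "integrable M (\<lambda>x. B * \<bar>f x\<bar>)"
    using assms(1) by simp
  show "AE x in M. norm (f x * w x) \<le> norm (B * \<bar>f x\<bar>)"
    using assms(3)
  proof eventually_elim
    case (elim x)
    then have "\<bar>f x\<bar> * \<bar>w x\<bar> \<le> \<bar>f x\<bar> * \<bar>B\<bar>" by (intro mult_left_mono) auto
    then show ?case by (simp add: abs_mult mult.commute)
  qed
  show "(\<lambda>x. f x * w x) \<in> borel_measurable M"
    using assms(1,2) by auto
qed

context open_domain
begin

lemma integrable_mult_C1c_test:
  assumes "integrable \<mu> f" "C1c_test \<Omega> \<phi> D"
  shows "integrable \<mu> (\<lambda>x. f x * \<phi> x)"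
proof -
  obtain B where "\<And>x. \<bar>\<phi> x\<bar> \<le> B"
    using C1c_test_bounded[OF assms(2)] by blast
  then show ?thesis
    by (intro integrable_mult_bounded[OF assms(1) C1c_test_measurable(1)[OF assms(2)]] AE_I2)
qed

context
  fixes u :: "'a \<Rightarrow> real" and G :: "'a \<Rightarrow> 'a"
  assumes u: "integrable \<mu> u" and u_nonneg: "AE x in \<mu>. 0 \<le> u x"
    and G: "square_integrable \<mu> G"
    and test_equation: "\<And>\<psi> P. C1c_test \<Omega> \<psi> P \<Longrightarrow> (LINT x|\<mu>. G x \<bullet> P x) = (LINT x|\<mu>. u x * \<psi> x)"
begin

lemma integrable_mult_abs_C1c_test:
  assumes "C1c_test \<Omega> \<psi> P"
  shows "integrable \<mu> (\<lambda>x. u x * \<bar>\<psi> x\<bar>)" "integrable \<mu> (\<lambda>x. u x * max 0 (\<psi> x))"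
proof -
  note [measurable] = C1c_test_measurable[OF assms]
  obtain B where B: "\<And>x. \<bar>\<psi> x\<bar> \<le> B"
    using C1c_test_bounded[OF assms] by blast
  have "\<bar>max 0 (\<psi> x)\<bar> \<le> B" for x
    using B[of x] by linarith
  then show "integrable \<mu> (\<lambda>x. u x * \<bar>\<psi> x\<bar>)" "integrable \<mu> (\<lambda>x. u x * max 0 (\<psi> x))"
    using B by (auto intro!: integrable_mult_bounded[OF u, where B = B])
qed

text \<open>Test with \<open>soft_pos \<epsilon> \<psi>\<close>, whose gradient is no larger than that of \<open>\<psi>\<close>.\<close>

lemma integral_pos_part_C1c_test_le:
  assumes \<psi>: "C1c_test \<Omega> \<psi> P"
  shows "(LINT x|\<mu>. u x * max 0 (\<psi> x)) \<le> sqrt (sq_norm \<mu> G) * sqrt (sq_norm \<mu> P)"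
proof (rule field_le_epsilon)
  fix e :: real assume "0 < e"
  note [measurable] = C1c_test_measurable[OF \<psi>]
  have "0 \<le> integral\<^sup>L \<mu> u"
    by (rule integral_nonneg_AE[OF u_nonneg])
  define \<epsilon> where "\<epsilon> = e / (integral\<^sup>L \<mu> u + 1)"
  have "0 < \<epsilon>" and \<epsilon>_le: "\<epsilon> * integral\<^sup>L \<mu> u \<le> e"
    using \<open>0 < e\<close> \<open>0 \<le> integral\<^sup>L \<mu> u\<close> by (auto simp: \<epsilon>_def field_simps)
  have test: "C1c_test \<Omega> (\<lambda>x. soft_pos \<epsilon> (\<psi> x)) (\<lambda>x. soft_pos' \<epsilon> (\<psi> x) *\<^sub>R P x)"
    using \<open>0 < \<epsilon>\<close>
    by (intro C1c_test_compose[OF \<psi>] has_field_derivative_soft_pos continuous_on_soft_pos')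
      (simp_all add: soft_pos_eq_0_iff)
  have "(LINT x|\<mu>. u x * max 0 (\<psi> x)) - \<epsilon> * integral\<^sup>L \<mu> u = (LINT x|\<mu>. u x * max 0 (\<psi> x) - \<epsilon> * u x)"
    using u integrable_mult_abs_C1c_test(2)[OF \<psi>] by simp
  also have "\<dots> \<le> (LINT x|\<mu>. u x * soft_pos \<epsilon> (\<psi> x))"
  proof (rule integral_mono_AE)
    show "AE x in \<mu>. u x * max 0 (\<psi> x) - \<epsilon> * u x \<le> u x * soft_pos \<epsilon> (\<psi> x)"
      using u_nonneg
    proof eventually_elim
      case (elim x)
      then have "u x * (max 0 (\<psi> x) - \<epsilon>) \<le> u x * soft_pos \<epsilon> (\<psi> x)"
        by (intro mult_left_mono soft_pos_ge[OF \<open>0 < \<epsilon>\<close>])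
      then show ?case by (simp add: algebra_simps)
    qed
  qed (use u integrable_mult_abs_C1c_test(2)[OF \<psi>] integrable_mult_C1c_test[OF u test] in auto)
  also have "\<dots> = (LINT x|\<mu>. G x \<bullet> (soft_pos' \<epsilon> (\<psi> x) *\<^sub>R P x))"
    by (rule test_equation[OF test, symmetric])
  also have "\<dots> \<le> sqrt (sq_norm \<mu> G) * sqrt (sq_norm \<mu> (\<lambda>x. soft_pos' \<epsilon> (\<psi> x) *\<^sub>R P x))"
    using Cauchy_Schwarz_sq_norm[OF G C1c_test_square_integrable(2)[OF test]] by linarith
  also have "\<dots> \<le> sqrt (sq_norm \<mu> G) * sqrt (sq_norm \<mu> P)"
  proof (intro mult_left_mono real_sqrt_le_mono)
    have [measurable]: "soft_pos' \<epsilon> \<in> borel_measurable borel"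
      by (rule borel_measurable_continuous_onI[OF continuous_on_soft_pos'[OF \<open>0 < \<epsilon>\<close>]])
    show "sq_norm \<mu> (\<lambda>x. soft_pos' \<epsilon> (\<psi> x) *\<^sub>R P x) \<le> sq_norm \<mu> P"
      using square_integrable_mult_bounded(2)[of "\<lambda>x. soft_pos' \<epsilon> (\<psi> x)" \<mu> 1 P]
        soft_pos'_bounds(2)[OF \<open>0 < \<epsilon>\<close>] C1c_test_square_integrable(2)[OF \<psi>] by simp
  qed simp
  finally show "(LINT x|\<mu>. u x * max 0 (\<psi> x)) \<le> sqrt (sq_norm \<mu> G) * sqrt (sq_norm \<mu> P) + e"
    using \<epsilon>_le by linarith
qed

lemma integral_abs_C1c_test_le:
  assumes \<psi>: "C1c_test \<Omega> \<psi> P"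
  shows "(LINT x|\<mu>. u x * \<bar>\<psi> x\<bar>) \<le> 2 * sqrt (sq_norm \<mu> G) * sqrt (sq_norm \<mu> P)"
proof -
  note neg = C1c_test_uminus[OF \<psi>]
  have "u x * \<bar>\<psi> x\<bar> = u x * max 0 (\<psi> x) + u x * max 0 (- \<psi> x)" for x
    by (simp add: max_def abs_if)
  then have "(LINT x|\<mu>. u x * \<bar>\<psi> x\<bar>)
      = (LINT x|\<mu>. u x * max 0 (\<psi> x)) + (LINT x|\<mu>. u x * max 0 (- \<psi> x))"
    using integrable_mult_abs_C1c_test(2)[OF \<psi>] integrable_mult_abs_C1c_test(2)[OF neg] by simp
  moreover have "sq_norm \<mu> (\<lambda>x. - P x) = sq_norm \<mu> P"
    by (simp add: sq_norm_def)
  ultimately show ?thesis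
    using integral_pos_part_C1c_test_le[OF \<psi>] integral_pos_part_C1c_test_le[OF neg] by simp
qed

lemma integral_abs_H10_le:
  assumes "H10 \<Omega> \<phi> D"
  shows "integrable \<mu> (\<lambda>x. u x * \<bar>\<phi> x\<bar>)"
    and "(LINT x|\<mu>. u x * \<bar>\<phi> x\<bar>) \<le> 2 * sqrt (sq_norm \<mu> G) * sqrt (sq_norm \<mu> D)"
proof -
  obtain \<psi> P where test: "\<And>k. C1c_test \<Omega> (\<psi> k) (P k)"
    and P: "L2_tendsto \<mu> P D" and lim: "AE x in \<mu>. (\<lambda>k. \<psi> k x) \<longlonglongrightarrow> \<phi> x"
    using H10_approximation[OF assms] by blast
  have abs_lim: "AE x in \<mu>. (\<lambda>k. u x * \<bar>\<psi> k x\<bar>) \<longlonglongrightarrow> u x * \<bar>\<phi> x\<bar>"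
    using lim by eventually_elim (intro tendsto_intros)
  have bound_lim: "(\<lambda>k. 2 * sqrt (sq_norm \<mu> G) * sqrt (sq_norm \<mu> (P k)))
      \<longlonglongrightarrow> 2 * sqrt (sq_norm \<mu> G) * sqrt (sq_norm \<mu> D)"
    by (intro tendsto_intros L2_tendsto_sq_norm[OF P])
  have nonneg: "AE x in \<mu>. 0 \<le> u x * \<bar>\<psi> k x\<bar>" for k
    using u_nonneg by eventually_elim simp
  have measurable: "(\<lambda>x. u x * \<bar>\<phi> x\<bar>) \<in> borel_measurable \<mu>"
    using u H10_measurable(1)[OF assms] by auto
  show "integrable \<mu> (\<lambda>x. u x * \<bar>\<phi> x\<bar>)"
      "(LINT x|\<mu>. u x * \<bar>\<phi> x\<bar>) \<le> 2 * sqrt (sq_norm \<mu> G) * sqrt (sq_norm \<mu> D)"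
    using Fatou_integrable[OF integrable_mult_abs_C1c_test(1)[OF test] nonneg measurable abs_lim
        integral_abs_C1c_test_le[OF test] bound_lim] by blast+
qed

lemma H10_equation:
  assumes "H10 \<Omega> \<phi> D"
  shows "integrable \<mu> (\<lambda>x. u x * \<phi> x)" "(LINT x|\<mu>. G x \<bullet> D x) = (LINT x|\<mu>. u x * \<phi> x)"
proof -
  have [measurable]: "u \<in> borel_measurable \<mu>"
    using u by auto
  show integrable: "integrable \<mu> (\<lambda>x. u x * \<phi> x)"
    using H10_measurable(1)[OF assms]
    by (intro Bochner_Integration.integrable_bound[OF integral_abs_H10_le(1)[OF assms]])
       (auto simp: abs_mult)
  obtain \<psi> P where test: "\<And>k. C1c_test \<Omega> (\<psi> k) (P k)" and P: "L2_tendsto \<mu> P D"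
    using assms by (auto simp: H10_iff_L2_tendsto)
  have diff: "H10 \<Omega> (\<lambda>x. \<psi> k x - \<phi> x) (\<lambda>x. P k x - D x)" for k
    by (intro H10_diff H10_of_C1c_test test assms)
  have "norm ((LINT x|\<mu>. u x * \<psi> k x) - (LINT x|\<mu>. u x * \<phi> x))
      \<le> 2 * sqrt (sq_norm \<mu> G) * sqrt (sq_norm \<mu> (\<lambda>x. P k x - D x))" for k
  proof -
    have "norm ((LINT x|\<mu>. u x * \<psi> k x) - (LINT x|\<mu>. u x * \<phi> x))
        = norm (LINT x|\<mu>. u x * (\<psi> k x - \<phi> x))"
      using integrable integrable_mult_C1c_test[OF u test[of k]] by (simp add: right_diff_distrib)
    also have "\<dots> \<le> (LINT x|\<mu>. norm (u x * (\<psi> k x - \<phi> x)))"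
      by (rule integral_norm_bound)
    also have "\<dots> = (LINT x|\<mu>. u x * \<bar>\<psi> k x - \<phi> x\<bar>)"
      using u_nonneg H10_measurable(1)[OF diff[of k]]
      by (intro integral_cong_AE) (auto elim!: eventually_mono simp: abs_mult)
    also have "\<dots> \<le> 2 * sqrt (sq_norm \<mu> G) * sqrt (sq_norm \<mu> (\<lambda>x. P k x - D x))"
      by (rule integral_abs_H10_le(2)[OF diff])
    finally show ?thesis .
  qed
  moreover have "(\<lambda>k. 2 * sqrt (sq_norm \<mu> G) * sqrt (sq_norm \<mu> (\<lambda>x. P k x - D x))) \<longlonglongrightarrow> 0"
    using L2_tendstoD(3)[OF P] by (auto intro!: tendsto_eq_intros)
  ultimately have "(\<lambda>k. (LINT x|\<mu>. u x * \<psi> k x) - (LINT x|\<mu>. u x * \<phi> x)) \<longlonglongrightarrow> 0"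
    by (rule Lim_null_comparison[OF always_eventually, OF allI])
  then have "(\<lambda>k. LINT x|\<mu>. G x \<bullet> P k x) \<longlonglongrightarrow> (LINT x|\<mu>. u x * \<phi> x)"
    by (simp add: LIM_zero_iff test_equation[OF test])
  then show "(LINT x|\<mu>. G x \<bullet> D x) = (LINT x|\<mu>. u x * \<phi> x)"
    by (rule LIMSEQ_unique[OF L2_tendsto_integral_inner[OF G P]])
qed

end

lemma weak_solutionI:
  assumes "H10 \<Omega> v G" "integrable \<mu> u" "AE x in \<mu>. 0 \<le> u x"
    and "\<And>\<psi> P. C1c_test \<Omega> \<psi> P \<Longrightarrow> (LINT x|\<mu>. G x \<bullet> P x) = (LINT x|\<mu>. u x * \<psi> x)"
  shows "weak_solution \<Omega> u v G"
  using assms(1) H10_equation[OF assms(2,3) H10_square_integrable(2)[OF assms(1)] assms(4)]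
  by (auto simp: weak_solution_def)

lemma weak_solution_cong_AE:
  assumes sol: "weak_solution \<Omega> u v G"
    and [measurable]: "u \<in> borel_measurable \<mu>" "u' \<in> borel_measurable \<mu>"
    and eq: "AE x in \<mu>. u x = u' x"
  shows "weak_solution \<Omega> u' v G"
  unfolding weak_solution_def
proof (intro conjI allI impI)
  fix \<phi> D assume \<phi>: "H10 \<Omega> \<phi> D"
  note [measurable] = H10_measurable(1)[OF \<phi>]
  have ae: "AE x in \<mu>. u x * \<phi> x = u' x * \<phi> x"
    using eq by eventually_elim simp
  show "integrable \<mu> (\<lambda>x. u' x * \<phi> x)"
    using weak_solutionD(2)[OF sol \<phi>] by (subst integrable_cong_AE[OF _ _ ae, symmetric]) auto
  show "(LINT x|\<mu>. G x \<bullet> D x) = (LINT x|\<mu>. u' x * \<phi> x)"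
    unfolding weak_solutionD(3)[OF sol \<phi>] by (rule integral_cong_AE[OF _ _ ae]) auto
qed (fact weak_solutionD(1)[OF sol])

lemma weak_solution_diff:
  assumes "weak_solution \<Omega> u v G" "weak_solution \<Omega> u' v' G'"
  shows "weak_solution \<Omega> (\<lambda>x. u x - u' x) (\<lambda>x. v x - v' x) (\<lambda>x. G x - G' x)"
  unfolding weak_solution_def
proof (intro conjI allI impI)
  show "H10 \<Omega> (\<lambda>x. v x - v' x) (\<lambda>x. G x - G' x)"
    by (intro H10_diff weak_solutionD(1)[OF assms(1)] weak_solutionD(1)[OF assms(2)])
  fix \<phi> D assume \<phi>: "H10 \<Omega> \<phi> D"
  note integrable = weak_solutionD(2)[OF assms(1) \<phi>] weak_solutionD(2)[OF assms(2) \<phi>]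
  show "integrable \<mu> (\<lambda>x. (u x - u' x) * \<phi> x)"
    using Bochner_Integration.integrable_diff[OF integrable] by (simp add: left_diff_distrib)
  have "integrable \<mu> (\<lambda>x. G x \<bullet> D x)" "integrable \<mu> (\<lambda>x. G' x \<bullet> D x)"
    by (intro square_integrable_inner H10_square_integrable(2)[OF weak_solutionD(1)[OF assms(1)]]
        H10_square_integrable(2)[OF weak_solutionD(1)[OF assms(2)]] H10_square_integrable(2)[OF \<phi>])+
  then show "(LINT x|\<mu>. (G x - G' x) \<bullet> D x) = (LINT x|\<mu>. (u x - u' x) * \<phi> x)"
    using integrable weak_solutionD(3)[OF assms(1) \<phi>] weak_solutionD(3)[OF assms(2) \<phi>]
    by (simp add: inner_diff_left left_diff_distrib)
qed

end

subsection \<open>Maximum principles\<close>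

context bounded_open_domain
begin

text \<open>Testing with \<open>\<theta>(v)\<close> gives \<open>\<integral> \<theta>'(v) |\<nabla>v|\<^sup>2 = \<integral> u \<theta>(v) \<le> 0\<close>, so that \<open>\<theta>(v)\<close> has zero gradient.\<close>

lemma weak_solution_compose_eq_0:
  assumes sol: "weak_solution \<Omega> u v G"
    and \<theta>: "\<And>s. (\<theta> has_field_derivative \<theta>' s) (at s)" "continuous_on UNIV \<theta>'" "\<theta> 0 = 0"
      "\<And>s. \<bar>\<theta>' s\<bar> \<le> B"
    and mono: "\<And>s. 0 \<le> \<theta>' s" and sign: "AE x in \<mu>. u x * \<theta> (v x) \<le> 0"
  shows "AE x in \<mu>. \<theta> (v x) = 0"
proof -
  let ?test = "\<lambda>x. \<theta>' (v x) *\<^sub>R G x"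
  note v = weak_solutionD(1)[OF sol]
  have H: "H10 \<Omega> (\<lambda>x. \<theta> (v x)) ?test"
    by (rule H10_compose[OF v \<theta>])
  have nonneg: "AE x in \<mu>. 0 \<le> G x \<bullet> ?test x"
    using mono by (intro AE_I2) simp
  have "(LINT x|\<mu>. G x \<bullet> ?test x) = (LINT x|\<mu>. u x * \<theta> (v x))"
    by (rule weak_solutionD(3)[OF sol H])
  also have "\<dots> \<le> 0"
    using integral_nonneg_AE[of "\<lambda>x. - (u x * \<theta> (v x))" \<mu>] sign by simp
  finally have "(LINT x|\<mu>. G x \<bullet> ?test x) = 0"
    using integral_nonneg_AE[OF nonneg] by linarith
  then have "AE x in \<mu>. G x \<bullet> ?test x = 0"
    using integral_nonneg_eq_0_iff_AE[OF square_integrable_inner nonneg]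
      H10_square_integrable(2)[OF v] H10_square_integrable(2)[OF H] by simp
  then have "AE x in \<mu>. ?test x = 0"
    by eventually_elim auto
  then show ?thesis
    by (rule H10_zero_gradient[OF H])
qed

lemma weak_solution_le:
  assumes sol: "weak_solution \<Omega> u v G" and "0 \<le> L" and u: "AE x in \<mu>. L < v x \<longrightarrow> u x \<le> 0"
  shows "AE x in \<mu>. v x \<le> L"
proof -
  have "AE x in \<mu>. soft_pos 1 (v x - L) = 0"
  proof (rule weak_solution_compose_eq_0[OF sol, where B = 1])
    show "((\<lambda>s. soft_pos 1 (s - L)) has_field_derivative soft_pos' 1 (s - L)) (at s)" for s
      using DERIV_chain2[OF has_field_derivative_soft_pos DERIV_diff[OF DERIV_ident DERIV_const]]
      by simp
    show "continuous_on UNIV (\<lambda>s. soft_pos' 1 (s - L))"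
      by (intro continuous_on_compose2[OF continuous_on_soft_pos'] continuous_intros) auto
    show "soft_pos 1 (0 - L) = 0"
      using \<open>0 \<le> L\<close> by (simp add: soft_pos_eq_0_iff)
    show "AE x in \<mu>. u x * soft_pos 1 (v x - L) \<le> 0"
      using u
    proof eventually_elim
      case (elim x)
      then show ?case
        using soft_pos_eq_0_iff[of 1 "v x - L"]
        by (cases "L < v x") (simp_all add: mult_nonpos_nonneg soft_pos_nonneg)
    qed
  qed (rule soft_pos'_bounds, simp)+
  then show ?thesis
    by (simp add: soft_pos_eq_0_iff)
qed

lemma weak_solution_zero: "weak_solution \<Omega> (\<lambda>x. 0) (\<lambda>x. 0) (\<lambda>x. 0)"
  using H10_of_C1c_test[OF C1c_test_zero] by (simp add: weak_solution_def)

lemma weak_solution_nonneg: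
  assumes "weak_solution \<Omega> u v G" "AE x in \<mu>. 0 \<le> u x"
  shows "AE x in \<mu>. 0 \<le> v x"
proof -
  have "AE x in \<mu>. 0 < 0 - v x \<longrightarrow> 0 - u x \<le> 0"
    using assms(2) by eventually_elim simp
  from weak_solution_le[OF weak_solution_diff[OF weak_solution_zero assms(1)] order_refl this]
  show ?thesis by simp
qed

lemma weak_solution_unique:
  assumes "weak_solution \<Omega> u v G" "weak_solution \<Omega> u' v' G'"
    and "AE x in \<mu>. (u x - u' x) * (v x - v' x) \<le> 0"
  shows "AE x in \<mu>. v x = v' x"
  using weak_solution_compose_eq_0[OF weak_solution_diff[OF assms(1,2)], of "\<lambda>s. s" "\<lambda>_. 1" 1]
      assms(3)
  by simp

end

section \<open>Minimisation of convex energies\<close>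

lemma tangent_le_of_antimono_derivative:
  fixes F g :: "real \<Rightarrow> real"
  assumes deriv: "\<And>s. (F has_real_derivative - g s) (at s)" and "antimono g"
  shows "convex_on UNIV F" "F a - g a * (b - a) \<le> F b"
proof -
  show convex: "convex_on UNIV F"
    by (rule convex_on_realI[OF connected_UNIV deriv]) (use \<open>antimono g\<close> in \<open>simp add: antimonoD\<close>)
  show "F a - g a * (b - a) \<le> F b"
    using convex_on_imp_above_tangent[OF convex connected_UNIV _ _ deriv, of a b] by simp
qed

lemma nonneg_antiderivative_of_antimono:
  fixes g :: "real \<Rightarrow> real"
  assumes cont: "continuous_on UNIV g" and "antimono g" and "g L = 0"
  obtains F where "\<And>s. (F has_real_derivative - g s) (at s)" "\<And>s. 0 \<le> F s"
proof -
  have "isCont (\<lambda>s. - g s) s" for s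
    using cont by (auto simp: continuous_on_eq_continuous_at)
  then obtain E where "\<And>s. (E has_real_derivative - g s) (at s)"
    using einterval_antiderivative[of "-\<infinity>" \<infinity> "\<lambda>s. - g s"]
    by (auto simp: has_real_derivative_iff_has_vector_derivative)
  then have deriv: "((\<lambda>s. E s - E L) has_real_derivative - g s) (at s)" for s
    by (auto intro!: derivative_eq_intros)
  have "0 \<le> E s - E L" for s
    using tangent_le_of_antimono_derivative(2)[OF deriv \<open>antimono g\<close>, of L s] \<open>g L = 0\<close> by simp
  then show thesis
    using deriv that by blast
qed

locale dirichlet_energy = bounded_open_domain \<Omega> for \<Omega> :: "'a::euclidean_space set" +
  fixes f :: "'a \<Rightarrow> real" and F g :: "real \<Rightarrow> real" and B :: real
  assumes f_integrable: "integrable \<mu> f" and f_nonneg: "AE x in \<mu>. 0 \<le> f x"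
    and F_nonneg: "0 \<le> F s" and F_deriv: "(F has_real_derivative - g s) (at s)"
    and g_continuous: "continuous_on UNIV g" and g_antimono: "antimono g" and g_bounded: "\<bar>g s\<bar> \<le> B"
begin

lemma F_continuous: "continuous_on UNIV F"
  using F_deriv by (intro DERIV_continuous_on) (auto intro: has_field_derivative_at_within)

lemma F_measurable [measurable]: "F \<in> borel_measurable borel"
  by (rule borel_measurable_continuous_onI[OF F_continuous])

lemma g_measurable [measurable]: "g \<in> borel_measurable borel"
  by (rule borel_measurable_continuous_onI[OF g_continuous])

lemmas F_convex = tangent_le_of_antimono_derivative(1)[OF F_deriv g_antimono]
  and F_tangent_le = tangent_le_of_antimono_derivative(2)[OF F_deriv g_antimono]

definition energy :: "('a \<Rightarrow> real) \<Rightarrow> ('a \<Rightarrow> 'a) \<Rightarrow> real" where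
  "energy \<phi> D = sq_norm \<mu> D / 2 + (LINT x|\<mu>. f x * F (\<phi> x))"

definition min_energy :: real where
  "min_energy = Inf {energy \<phi> D |\<phi> D. C1c_test \<Omega> \<phi> D}"

lemma integrable_potential:
  assumes "C1c_test \<Omega> \<phi> D"
  shows "integrable \<mu> (\<lambda>x. f x * F (\<phi> x))"
proof -
  note [measurable] = C1c_test_measurable[OF assms]
  obtain R where R: "\<And>x. \<bar>\<phi> x\<bar> \<le> R"
    using C1c_test_bounded[OF assms] by blast
  have "bounded (F ` {-R..R})"
    by (intro compact_imp_bounded compact_continuous_image compact_Icc
        continuous_on_subset[OF F_continuous]) simp
  then obtain K where "\<forall>s\<in>{-R..R}. \<bar>F s\<bar> \<le> K"
    by (auto simp: bounded_iff)
  then have "\<bar>F (\<phi> x)\<bar> \<le> K" for x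
    using R[of x] by (simp add: abs_le_iff minus_le_iff)
  then show ?thesis
    by (intro integrable_mult_bounded[OF f_integrable, where B = K]) auto
qed

lemma energy_nonneg: "0 \<le> energy \<phi> D"
proof -
  have "AE x in \<mu>. 0 \<le> f x * F (\<phi> x)"
    using f_nonneg by eventually_elim (simp add: F_nonneg)
  then show ?thesis
    unfolding energy_def by (intro add_nonneg_nonneg integral_nonneg_AE) auto
qed

lemma min_energy_le:
  assumes "C1c_test \<Omega> \<phi> D"
  shows "min_energy \<le> energy \<phi> D"
  unfolding min_energy_def using assms energy_nonneg
  by (intro cInf_lower bdd_belowI[of _ 0]) auto

lemma energy_midpoint_le:
  assumes \<phi>: "C1c_test \<Omega> \<phi> D" and \<psi>: "C1c_test \<Omega> \<psi> E"
  shows "energy (\<lambda>x. 1/2 * \<phi> x + 1/2 * \<psi> x) (\<lambda>x. (1/2) *\<^sub>R D x + (1/2) *\<^sub>R E x)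
      + sq_norm \<mu> (\<lambda>x. D x - E x) / 8 \<le> (energy \<phi> D + energy \<psi> E) / 2"
proof -
  note mid = C1c_test_add_scaleR[OF \<phi> \<psi>, of "1/2" "1/2"]
  have "(LINT x|\<mu>. f x * F (1/2 * \<phi> x + 1/2 * \<psi> x))
      \<le> (LINT x|\<mu>. 1/2 * (f x * F (\<phi> x)) + 1/2 * (f x * F (\<psi> x)))"
  proof (rule integral_mono_AE)
    show "AE x in \<mu>. f x * F (1/2 * \<phi> x + 1/2 * \<psi> x)
        \<le> 1/2 * (f x * F (\<phi> x)) + 1/2 * (f x * F (\<psi> x))"
      using f_nonneg
    proof eventually_elim
      case (elim x)
      have "F (1/2 * \<phi> x + 1/2 * \<psi> x) \<le> 1/2 * F (\<phi> x) + 1/2 * F (\<psi> x)"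
        using convex_onD[OF F_convex, of "1/2" "\<phi> x" "\<psi> x"] by simp
      from mult_left_mono[OF this elim] show ?case
        by (simp add: algebra_simps)
    qed
  qed (use integrable_potential[OF mid] integrable_potential[OF \<phi>] integrable_potential[OF \<psi>]
      in auto)
  then show ?thesis
    using parallelogram_law_sq_norm[OF C1c_test_square_integrable(2)[OF \<phi>]
        C1c_test_square_integrable(2)[OF \<psi>]]
      integrable_potential[OF \<phi>] integrable_potential[OF \<psi>]
    by (simp add: energy_def)
qed

lemma sq_norm_diff_near_minimizers_le:
  assumes \<phi>: "C1c_test \<Omega> \<phi> D" "energy \<phi> D \<le> min_energy + a"
    and \<psi>: "C1c_test \<Omega> \<psi> E" "energy \<psi> E \<le> min_energy + b"
  shows "sq_norm \<mu> (\<lambda>x. D x - E x) \<le> 4 * (a + b)"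
  using energy_midpoint_le[OF \<phi>(1) \<psi>(1)]
    min_energy_le[OF C1c_test_add_scaleR[OF \<phi>(1) \<psi>(1), of "1/2" "1/2"]]
    \<phi>(2) \<psi>(2) by argo

lemma integrable_variation:
  assumes [measurable]: "\<phi> \<in> borel_measurable \<mu>" and \<psi>: "C1c_test \<Omega> \<psi> P"
  shows "integrable \<mu> (\<lambda>x. f x * (g (\<phi> x) * \<psi> x))"
proof -
  have "integrable \<mu> (\<lambda>x. f x * g (\<phi> x))"
    using g_bounded by (intro integrable_mult_bounded[OF f_integrable]) auto
  from integrable_mult_C1c_test[OF this \<psi>] show ?thesis
    by (simp add: mult.assoc)
qed

lemma energy_perturbation_le:
  assumes \<phi>: "C1c_test \<Omega> \<phi> D" and \<psi>: "C1c_test \<Omega> \<psi> P"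
  shows "energy (\<lambda>x. \<phi> x + t * \<psi> x) (\<lambda>x. D x + t *\<^sub>R P x)
    \<le> energy \<phi> D + t * (LINT x|\<mu>. P x \<bullet> D x) + t\<^sup>2 * sq_norm \<mu> P / 2
      - t * (LINT x|\<mu>. f x * (g (\<phi> x + t * \<psi> x) * \<psi> x))"
proof -
  let ?\<phi> = "\<lambda>x. \<phi> x + t * \<psi> x"
  note [measurable] = C1c_test_measurable[OF \<phi>] C1c_test_measurable[OF \<psi>]
  have test: "C1c_test \<Omega> ?\<phi> (\<lambda>x. D x + t *\<^sub>R P x)"
    using C1c_test_add_scaleR[OF \<phi> \<psi>, of 1 t] by simp
  have variation: "integrable \<mu> (\<lambda>x. f x * (g (?\<phi> x) * \<psi> x))"
    by (rule integrable_variation[OF _ \<psi>]) measurable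
  have "(LINT x|\<mu>. f x * F (?\<phi> x) + t * (f x * (g (?\<phi> x) * \<psi> x))) \<le> (LINT x|\<mu>. f x * F (\<phi> x))"
  proof (rule integral_mono_AE)
    show "AE x in \<mu>. f x * F (?\<phi> x) + t * (f x * (g (?\<phi> x) * \<psi> x)) \<le> f x * F (\<phi> x)"
      using f_nonneg
    proof eventually_elim
      case (elim x)
      have "F (?\<phi> x) + t * (g (?\<phi> x) * \<psi> x) \<le> F (\<phi> x)"
        using F_tangent_le[of "?\<phi> x" "\<phi> x"] by (simp add: algebra_simps)
      from mult_left_mono[OF this elim] show ?case
        by (simp add: algebra_simps)
    qed
  qed (use integrable_potential[OF test] variation integrable_potential[OF \<phi>] in auto)
  then show ?thesis
    using sq_norm_add_scaleR[OF C1c_test_square_integrable(2)[OF \<phi>]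
        C1c_test_square_integrable(2)[OF \<psi>], of t]
      integrable_potential[OF test] variation
    by (simp add: energy_def inner_commute field_simps)
qed

lemma near_minimizer_variation_le:
  assumes \<phi>: "C1c_test \<Omega> \<phi> D" "energy \<phi> D \<le> min_energy + t\<^sup>2" and "0 < t" and \<psi>: "C1c_test \<Omega> \<psi> P"
  shows "(LINT x|\<mu>. f x * (g (\<phi> x + t * \<psi> x) * \<psi> x))
      \<le> (LINT x|\<mu>. P x \<bullet> D x) + t * (sq_norm \<mu> P / 2 + 1)"
proof -
  let ?I = "LINT x|\<mu>. f x * (g (\<phi> x + t * \<psi> x) * \<psi> x)"
  have "min_energy \<le> energy (\<lambda>x. \<phi> x + t * \<psi> x) (\<lambda>x. D x + t *\<^sub>R P x)"
    using min_energy_le[OF C1c_test_add_scaleR[OF \<phi>(1) \<psi>, of 1 t]] by simp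
  then have "t * ?I \<le> t * (LINT x|\<mu>. P x \<bullet> D x) + t\<^sup>2 * sq_norm \<mu> P / 2 + t\<^sup>2"
    using energy_perturbation_le[OF \<phi>(1) \<psi>, of t] \<phi>(2) by linarith
  also have "\<dots> = t * ((LINT x|\<mu>. P x \<bullet> D x) + t * (sq_norm \<mu> P / 2 + 1))"
    by (simp add: power2_eq_square algebra_simps)
  finally show ?thesis
    using \<open>0 < t\<close> by simp
qed

lemma minimizing_sequence:
  assumes t: "\<And>k. 0 < t k" "t \<longlonglongrightarrow> 0"
  obtains \<phi> D where "\<And>k. C1c_test \<Omega> (\<phi> k) (D k)"
    "\<And>k. energy (\<phi> k) (D k) \<le> min_energy + (t k)\<^sup>2" "L2_Cauchy \<mu> D"
proof -
  have "\<exists>\<phi> D. C1c_test \<Omega> \<phi> D \<and> energy \<phi> D < min_energy + (t k)\<^sup>2" for k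
    using cInf_lessD[of "{energy \<phi> D |\<phi> D. C1c_test \<Omega> \<phi> D}" "min_energy + (t k)\<^sup>2"]
      C1c_test_zero t(1)[of k]
    unfolding min_energy_def by fastforce
  then obtain \<phi> D where test: "\<And>k. C1c_test \<Omega> (\<phi> k) (D k)"
    and near: "\<And>k. energy (\<phi> k) (D k) \<le> min_energy + (t k)\<^sup>2"
    by (metis less_imp_le)
  have "L2_Cauchy \<mu> D"
    unfolding L2_Cauchy_def
  proof (intro conjI allI impI)
    fix e :: real assume "0 < e"
    have "(\<lambda>k. (t k)\<^sup>2) \<longlonglongrightarrow> 0"
      using tendsto_power[OF t(2), of 2] by simp
    then have "\<forall>\<^sub>F k in sequentially. (t k)\<^sup>2 < e / 8"
      by (rule order_tendstoD) (use \<open>0 < e\<close> in simp)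
    then obtain N where N: "\<And>k. N \<le> k \<Longrightarrow> (t k)\<^sup>2 < e / 8"
      by (auto simp: eventually_sequentially)
    have "sq_norm \<mu> (\<lambda>x. D j x - D k x) < e" if "N \<le> j" "N \<le> k" for j k
      using sq_norm_diff_near_minimizers_le[OF test near test near, of j k]
        N[OF that(1)] N[OF that(2)]
      by argo
    then show "\<exists>N. \<forall>j\<ge>N. \<forall>k\<ge>N. sq_norm \<mu> (\<lambda>x. D j x - D k x) < e"
      by blast
  qed (rule C1c_test_square_integrable(2)[OF test])
  then show thesis
    using that test near by blast
qed

lemma variation_tendsto:
  assumes [measurable]: "\<And>k. \<phi> k \<in> borel_measurable \<mu>" "v \<in> borel_measurable \<mu>"
    and lim: "AE x in \<mu>. (\<lambda>k. \<phi> k x) \<longlonglongrightarrow> v x" and \<psi>: "C1c_test \<Omega> \<psi> P" and t: "t \<longlonglongrightarrow> 0"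
  shows "(\<lambda>k. LINT x|\<mu>. f x * (g (\<phi> k x + t k * \<psi> x) * \<psi> x)) \<longlonglongrightarrow> (LINT x|\<mu>. f x * (g (v x) * \<psi> x))"
proof (rule integral_dominated_convergence[where w = "\<lambda>x. B * \<bar>f x * \<psi> x\<bar>"])
  note [measurable] = C1c_test_measurable[OF \<psi>] borel_measurable_integrable[OF f_integrable]
  show "(\<lambda>x. f x * (g (\<phi> k x + t k * \<psi> x) * \<psi> x)) \<in> borel_measurable \<mu>"
    "(\<lambda>x. f x * (g (v x) * \<psi> x)) \<in> borel_measurable \<mu>" for k
    by measurable
  show "integrable \<mu> (\<lambda>x. B * \<bar>f x * \<psi> x\<bar>)"
    using integrable_mult_C1c_test[OF f_integrable \<psi>] by simp
  show "AE x in \<mu>. (\<lambda>k. f x * (g (\<phi> k x + t k * \<psi> x) * \<psi> x)) \<longlonglongrightarrow> f x * (g (v x) * \<psi> x)"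
    using lim
  proof eventually_elim
    case (elim x)
    have "(\<lambda>k. \<phi> k x + t k * \<psi> x) \<longlonglongrightarrow> v x"
      using elim t by (auto intro!: tendsto_eq_intros)
    then have "(\<lambda>k. g (\<phi> k x + t k * \<psi> x)) \<longlonglongrightarrow> g (v x)"
      by (auto intro: continuous_on_tendsto_compose[OF g_continuous])
    then show ?case by (intro tendsto_intros)
  qed
  show "AE x in \<mu>. norm (f x * (g (\<phi> k x + t k * \<psi> x) * \<psi> x)) \<le> B * \<bar>f x * \<psi> x\<bar>" for k
  proof (rule AE_I2)
    fix x
    have "\<bar>g (\<phi> k x + t k * \<psi> x)\<bar> * \<bar>f x * \<psi> x\<bar> \<le> B * \<bar>f x * \<psi> x\<bar>"
      by (intro mult_right_mono g_bounded) simp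
    then show "norm (f x * (g (\<phi> k x + t k * \<psi> x) * \<psi> x)) \<le> B * \<bar>f x * \<psi> x\<bar>"
      by (simp add: abs_mult mult_ac)
  qed
qed

theorem euler_lagrange:
  obtains v G where "H10 \<Omega> v G"
    "\<And>\<psi> P. C1c_test \<Omega> \<psi> P \<Longrightarrow> (LINT x|\<mu>. G x \<bullet> P x) = (LINT x|\<mu>. f x * g (v x) * \<psi> x)"
proof -
  define t where "t k = inverse (real (Suc k))" for k
  have t: "0 < t k" "t \<longlonglongrightarrow> 0" for k
    using LIMSEQ_inverse_real_of_nat by (simp_all add: t_def[abs_def])
  obtain \<phi> D where test: "\<And>k. C1c_test \<Omega> (\<phi> k) (D k)"
    and near: "\<And>k. energy (\<phi> k) (D k) \<le> min_energy + (t k)\<^sup>2" and "L2_Cauchy \<mu> D"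
    using minimizing_sequence[OF t] by blast
  obtain v G where lim: "L2_tendsto \<mu> \<phi> v" "L2_tendsto \<mu> D G"
    using H10_limit_of_Cauchy_gradients[OF test \<open>L2_Cauchy \<mu> D\<close>] .
  have H: "H10 \<Omega> v G"
    unfolding H10_iff_L2_tendsto using test lim by blast
  obtain r where "strict_mono r" and AE_lim: "AE x in \<mu>. (\<lambda>k. \<phi> (r k) x) \<longlonglongrightarrow> v x"
    using L2_tendsto_AE_subseq[OF lim(1)] .
  have t_lim: "(\<lambda>k. t (r k)) \<longlonglongrightarrow> 0"
    using LIMSEQ_subseq_LIMSEQ[OF t(2) \<open>strict_mono r\<close>] by (simp add: o_def)
  have le: "(LINT x|\<mu>. f x * (g (v x) * \<psi> x)) \<le> (LINT x|\<mu>. P x \<bullet> G x)"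
    if \<psi>: "C1c_test \<Omega> \<psi> P" for \<psi> P
  proof (rule LIMSEQ_le)
    show "(\<lambda>k. LINT x|\<mu>. f x * (g (\<phi> (r k) x + t (r k) * \<psi> x) * \<psi> x))
        \<longlonglongrightarrow> (LINT x|\<mu>. f x * (g (v x) * \<psi> x))"
      by (rule variation_tendsto[OF C1c_test_measurable(1)[OF test] H10_measurable(1)[OF H]
            AE_lim \<psi> t_lim])
    show "(\<lambda>k. (LINT x|\<mu>. P x \<bullet> D (r k) x) + t (r k) * (sq_norm \<mu> P / 2 + 1))
        \<longlonglongrightarrow> (LINT x|\<mu>. P x \<bullet> G x)"
      using L2_tendsto_integral_inner[OF C1c_test_square_integrable(2)[OF \<psi>]
          L2_tendsto_subseq[OF lim(2) \<open>strict_mono r\<close>]]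
        t_lim by (auto intro!: tendsto_eq_intros)
    show "\<exists>N. \<forall>k\<ge>N. (LINT x|\<mu>. f x * (g (\<phi> (r k) x + t (r k) * \<psi> x) * \<psi> x))
        \<le> (LINT x|\<mu>. P x \<bullet> D (r k) x) + t (r k) * (sq_norm \<mu> P / 2 + 1)"
      using near_minimizer_variation_le[OF test near t(1) \<psi>] by blast
  qed
  have "(LINT x|\<mu>. G x \<bullet> P x) = (LINT x|\<mu>. f x * g (v x) * \<psi> x)" if \<psi>: "C1c_test \<Omega> \<psi> P" for \<psi> P
    using le[OF \<psi>] le[OF C1c_test_uminus[OF \<psi>]] by (simp add: inner_commute mult.assoc)
  then show thesis
    using that H by blast
qed

end

section \<open>The semilinear problem\<close>

locale semilinear_dirichlet = bounded_open_domain \<Omega> for \<Omega> :: "'a::euclidean_space set" +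
  fixes f :: "'a \<Rightarrow> real" and g :: "real \<Rightarrow> real" and L :: real
  assumes f_integrable: "integrable \<mu> f" and f_nonneg: "AE x in \<mu>. 0 \<le> f x"
    and g_measurable [measurable]: "g \<in> borel_measurable borel"
    and g_continuous: "continuous_on {0..} g" and g_antimono: "antimono_on {0..} g"
    and g_nonneg: "0 \<le> s \<Longrightarrow> 0 \<le> g s" and L_nonneg: "0 \<le> L" and g_L: "g L = 0"
begin

lemma f_measurable [measurable]: "f \<in> borel_measurable \<mu>"
  using f_integrable by auto

lemma g_le: "0 \<le> s \<Longrightarrow> g s \<le> g 0"
  using g_antimono by (simp add: monotone_on_def)

lemma g_eq_0: "L \<le> s \<Longrightarrow> g s = 0"
  using g_antimono g_nonneg[of s] g_L L_nonneg by (force simp: monotone_on_def)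

lemma source_integrable_nonneg:
  assumes [measurable]: "v \<in> borel_measurable \<mu>" and v: "AE x in \<mu>. 0 \<le> v x"
  shows "integrable \<mu> (\<lambda>x. f x * g (v x))" "AE x in \<mu>. 0 \<le> f x * g (v x)"
proof -
  have "AE x in \<mu>. \<bar>g (v x)\<bar> \<le> g 0"
    using v by eventually_elim (simp add: g_le g_nonneg)
  then show "integrable \<mu> (\<lambda>x. f x * g (v x))"
    by (rule integrable_mult_bounded[OF f_integrable, rotated]) measurable
  show "AE x in \<mu>. 0 \<le> f x * g (v x)"
    using v f_nonneg by eventually_elim (simp add: g_nonneg)
qed

text \<open>
  Values of \<open>g\<close> at negative arguments carry no information, hence the detour through \<open>g (max 0 s)\<close>.
\<close>

theorem solution_exists:
  obtains v G where "weak_solution \<Omega> (\<lambda>x. f x * g (v x)) v G" "AE x in \<mu>. 0 \<le> v x \<and> v x \<le> L"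
proof -
  define g0 where "g0 s = g (max 0 s)" for s
  have g0: "continuous_on UNIV g0" "antimono g0" "g0 L = 0" "\<And>s. 0 \<le> g0 s" "\<And>s. \<bar>g0 s\<bar> \<le> g 0"
    using g_antimono g_L L_nonneg
    by (auto simp: g0_def g_nonneg g_le monotone_on_def
        intro!: continuous_on_compose2[OF g_continuous] continuous_intros)
  obtain F where F: "\<And>s. (F has_real_derivative - g0 s) (at s)" "\<And>s. 0 \<le> F s"
    using nonneg_antiderivative_of_antimono[OF g0(1-3)] by blast
  interpret dirichlet_energy \<Omega> f F g0 "g 0"
    by unfold_locales (fact f_integrable f_nonneg F g0)+
  obtain v G where H: "H10 \<Omega> v G"
    and eq: "\<And>\<psi> P. C1c_test \<Omega> \<psi> P \<Longrightarrow> (LINT x|\<mu>. G x \<bullet> P x) = (LINT x|\<mu>. f x * g0 (v x) * \<psi> x)"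
    using euler_lagrange by blast
  note [measurable] = H10_measurable(1)[OF H]
  have source: "integrable \<mu> (\<lambda>x. f x * g0 (v x))" "AE x in \<mu>. 0 \<le> f x * g0 (v x)"
    using source_integrable_nonneg[of "\<lambda>x. max 0 (v x)"] by (auto simp: g0_def)
  have sol: "weak_solution \<Omega> (\<lambda>x. f x * g0 (v x)) v G"
    by (rule weak_solutionI[OF H source eq])
  have nonneg: "AE x in \<mu>. 0 \<le> v x"
    by (rule weak_solution_nonneg[OF sol source(2)])
  have "AE x in \<mu>. v x \<le> L"
    by (rule weak_solution_le[OF sol L_nonneg]) (simp add: g0_def g_eq_0)
  with nonneg have bounds: "AE x in \<mu>. 0 \<le> v x \<and> v x \<le> L"
    by eventually_elim simp
  have "AE x in \<mu>. f x * g0 (v x) = f x * g (v x)"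
    using nonneg by eventually_elim (simp add: g0_def)
  then have "weak_solution \<Omega> (\<lambda>x. f x * g (v x)) v G"
    by (rule weak_solution_cong_AE[OF sol, rotated 2]) measurable
  then show thesis
    using bounds that by blast
qed

theorem solution_unique:
  assumes v: "weak_solution \<Omega> (\<lambda>x. f x * g (v x)) v G" "AE x in \<mu>. 0 \<le> v x"
    and w: "weak_solution \<Omega> (\<lambda>x. f x * g (w x)) w W" "AE x in \<mu>. 0 \<le> w x"
  shows "AE x in \<mu>. v x = w x"
proof (rule weak_solution_unique[OF v(1) w(1)])
  show "AE x in \<mu>. (f x * g (v x) - f x * g (w x)) * (v x - w x) \<le> 0"
    using v(2) w(2) f_nonneg
  proof eventually_elim
    case (elim x)
    then have "(g (v x) - g (w x)) * (v x - w x) \<le> 0"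
      using g_antimono by (cases "v x \<le> w x")
        (auto simp: monotone_on_def intro: mult_nonneg_nonpos mult_nonpos_nonneg)
    from mult_nonneg_nonpos[OF elim(3) this] show ?case
      by (simp add: algebra_simps)
  qed
qed

lemma weak_solution_of_equation:
  assumes H: "H10 \<Omega> w W" and "AE x in \<mu>. 0 \<le> w x"
    and eq: "\<And>\<phi> D. H10 \<Omega> \<phi> D \<Longrightarrow> (LINT x|\<mu>. W x \<bullet> D x) = (LINT x|\<mu>. f x * g (w x) * \<phi> x)"
  shows "weak_solution \<Omega> (\<lambda>x. f x * g (w x)) w W"
  by (rule weak_solutionI[OF H source_integrable_nonneg[OF H10_measurable(1)[OF H] assms(2)]
        eq[OF H10_of_C1c_test]])

end

section \<open>The nonlinearity\<close>

lemma strict_mono_on_the_inv_into: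
  fixes \<Psi> :: "real \<Rightarrow> real"
  assumes "a \<le> b" and cont: "continuous_on {a..b} \<Psi>" and mono: "strict_mono_on {a..b} \<Psi>"
  shows "\<Psi> ` {a..b} = {\<Psi> a..\<Psi> b}"
    and "continuous_on {\<Psi> a..\<Psi> b} (the_inv_into {a..b} \<Psi>)"
    and "mono_on {\<Psi> a..\<Psi> b} (the_inv_into {a..b} \<Psi>)"
proof -
  note inj = strict_mono_on_imp_inj_on[OF mono]
  show image: "\<Psi> ` {a..b} = {\<Psi> a..\<Psi> b}"
  proof
    show "\<Psi> ` {a..b} \<subseteq> {\<Psi> a..\<Psi> b}"
      using strict_mono_on_leD[OF mono] \<open>a \<le> b\<close> by auto
    show "{\<Psi> a..\<Psi> b} \<subseteq> \<Psi> ` {a..b}"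
      using IVT'[OF _ _ \<open>a \<le> b\<close> cont] by fastforce
  qed
  show "continuous_on {\<Psi> a..\<Psi> b} (the_inv_into {a..b} \<Psi>)"
    using continuous_on_inv_into[OF cont compact_Icc inj] by (simp add: image)
  show "mono_on {\<Psi> a..\<Psi> b} (the_inv_into {a..b} \<Psi>)"
  proof (rule mono_onI)
    fix r s assume "r \<in> {\<Psi> a..\<Psi> b}" "s \<in> {\<Psi> a..\<Psi> b}" "r \<le> s"
    then obtain x y where "x \<in> {a..b}" "y \<in> {a..b}" "r = \<Psi> x" "s = \<Psi> y"
      using image by (metis imageE)
    then show "the_inv_into {a..b} \<Psi> r \<le> the_inv_into {a..b} \<Psi> s"
      using \<open>r \<le> s\<close> strict_mono_on_less_eq[OF mono] by (simp add: the_inv_into_f_f[OF inj])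
  qed
qed

lemma has_real_derivative_Hf:
  assumes "continuous_on {0..<\<sigma>} h" "0 < s" "s < \<sigma>"
  shows "(Hf h has_real_derivative h s) (at s)"
proof -
  obtain b where "s < b" "b < \<sigma>"
    using dense[OF assms(3)] by blast
  then have "((\<lambda>s. integral {0..s} h) has_real_derivative h s) (at s within {0..b})"
    using assms by (intro integral_has_real_derivative continuous_on_subset[OF assms(1)]) auto
  then show ?thesis
    using \<open>0 < s\<close> \<open>s < b\<close> by (simp add: Hf_def[abs_def] at_within_Icc_at)
qed

lemma eventually_inverse_distance_le:
  fixes h :: "real \<Rightarrow> real"
  assumes "1 \<le> \<gamma>" and "0 < C"
    and lim: "((\<lambda>s. (\<sigma> - s) powr \<gamma> * h s) \<longlongrightarrow> C) (at_left \<sigma>)"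
  shows "\<forall>\<^sub>F s in at_left \<sigma>. (C / 2) / (\<sigma> - s) \<le> h s"
proof -
  have "\<forall>\<^sub>F s in at_left \<sigma>. C / 2 < (\<sigma> - s) powr \<gamma> * h s"
    using lim by (rule order_tendstoD) (use \<open>0 < C\<close> in simp)
  moreover have "\<forall>\<^sub>F s in at_left \<sigma>. s \<in> {\<sigma> - 1<..<\<sigma>}"
    by (rule eventually_at_leftI[of "\<sigma> - 1"]) auto
  ultimately show ?thesis
  proof eventually_elim
    case (elim s)
    then have "0 < (\<sigma> - s) powr \<gamma> * h s"
      using \<open>0 < C\<close> by linarith
    then have "0 < h s"
      by (simp add: zero_less_mult_iff)
    moreover have "(\<sigma> - s) powr \<gamma> \<le> (\<sigma> - s) powr 1"
      using elim \<open>1 \<le> \<gamma>\<close> by (intro powr_mono') auto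
    ultimately have "(\<sigma> - s) powr \<gamma> * h s \<le> (\<sigma> - s) * h s"
      using elim by (intro mult_right_mono) auto
    then show ?case
      using elim by (simp add: field_simps)
  qed
qed

text \<open>\<open>H s + c ln (\<sigma> - s)\<close> is nondecreasing near \<open>\<sigma>\<close>.\<close>

lemma filterlim_Hf_at_top:
  fixes h :: "real \<Rightarrow> real"
  assumes "0 < \<sigma>" and cont: "continuous_on {0..<\<sigma>} h" and "0 < c"
    and lower: "\<forall>\<^sub>F s in at_left \<sigma>. c / (\<sigma> - s) \<le> h s"
  shows "filterlim (Hf h) at_top (at_left \<sigma>)"
proof -
  obtain b where "b < \<sigma>" and b: "\<And>s. b < s \<Longrightarrow> s < \<sigma> \<Longrightarrow> c / (\<sigma> - s) \<le> h s"
    using lower by (auto simp: eventually_at_left_field)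
  obtain a where "max 0 b < a" "a < \<sigma>"
    using dense[of "max 0 b" \<sigma>] \<open>0 < \<sigma>\<close> \<open>b < \<sigma>\<close> by auto
  have le: "Hf h a + c * ln (\<sigma> - a) \<le> Hf h s + c * ln (\<sigma> - s)" if "a \<le> s" "s < \<sigma>" for s
  proof (rule DERIV_nonneg_imp_nondecreasing[OF \<open>a \<le> s\<close>])
    fix t assume "a \<le> t" "t \<le> s"
    then have t: "0 < t" "b < t" "t < \<sigma>"
      using \<open>max 0 b < a\<close> \<open>s < \<sigma>\<close> by auto
    then have "((\<lambda>t. Hf h t + c * ln (\<sigma> - t)) has_real_derivative h t - c / (\<sigma> - t)) (at t)"
      by (auto intro!: derivative_eq_intros has_real_derivative_Hf[OF cont])
    then show "\<exists>y. ((\<lambda>t. Hf h t + c * ln (\<sigma> - t)) has_real_derivative y) (at t) \<and> 0 \<le> y"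
      using b[OF t(2,3)] by (intro exI[of _ "h t - c / (\<sigma> - t)"]) simp
  qed
  have "filterlim (\<lambda>s. \<sigma> - s) (at_right 0) (at_left \<sigma>)"
    unfolding filterlim_at by (auto intro!: tendsto_eq_intros simp: eventually_at_filter)
  then have "filterlim (\<lambda>s. ln (\<sigma> - s)) at_bot (at_left \<sigma>)"
    by (rule filterlim_compose[OF ln_at_0])
  then have "filterlim (\<lambda>s. c * - ln (\<sigma> - s)) at_top (at_left \<sigma>)"
    using \<open>0 < c\<close>
    by (intro filterlim_tendsto_pos_mult_at_top[OF tendsto_const])
       (auto simp: filterlim_uminus_at_top)
  then have "filterlim (\<lambda>s. Hf h a + c * ln (\<sigma> - a) + c * - ln (\<sigma> - s)) at_top (at_left \<sigma>)"
    by (rule filterlim_tendsto_add_at_top[OF tendsto_const])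
  moreover have "\<forall>\<^sub>F s in at_left \<sigma>. s \<in> {a<..<\<sigma>}"
    using \<open>a < \<sigma>\<close> by (rule eventually_at_leftI[of a, rotated]) simp
  then have "\<forall>\<^sub>F s in at_left \<sigma>. Hf h a + c * ln (\<sigma> - a) + c * - ln (\<sigma> - s) \<le> Hf h s"
  proof eventually_elim
    case (elim s)
    then show ?case using le[of s] by simp
  qed
  ultimately show ?thesis
    by (rule filterlim_at_top_mono)
qed

locale singular_weight =
  fixes h :: "real \<Rightarrow> real" and \<sigma> :: real
  assumes \<sigma>_pos: "0 < \<sigma>" and h_continuous: "continuous_on {0..<\<sigma>} h"
    and h_nonneg: "s \<in> {0..<\<sigma>} \<Longrightarrow> 0 \<le> h s" and Hf_at_top: "filterlim (Hf h) at_top (at_left \<sigma>)"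
begin

definition weight :: "real \<Rightarrow> real" where
  "weight t = (if t < \<sigma> then exp (- Hf h t) else 0)"

definition Psi :: "real \<Rightarrow> real" where
  "Psi s = integral {0..s} weight"

lemma h_integrable: "s < \<sigma> \<Longrightarrow> h integrable_on {0..s}"
  by (intro integrable_continuous_real continuous_on_subset[OF h_continuous]) auto

lemma Hf_continuous: "continuous_on {0..<\<sigma>} (Hf h)"
  unfolding continuous_on_eq_continuous_within
proof
  fix s assume s: "s \<in> {0..<\<sigma>}"
  then obtain b where b: "s < b" "b < \<sigma>"
    using dense[of s \<sigma>] by auto
  have "continuous_on {0..b} (Hf h)"
    unfolding Hf_def using h_integrable[OF b(2)] by (rule indefinite_integral_continuous_1)
  then have "continuous (at s within {0..b}) (Hf h)"
    using s b by (simp add: continuous_on_eq_continuous_within)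
  moreover have "at s within {0..<\<sigma>} = at s within {0..b}"
    using b by (intro at_within_nhd[of s "{..<b}"]) auto
  ultimately show "continuous (at s within {0..<\<sigma>}) (Hf h)" by simp
qed

lemma Hf_mono: "0 \<le> a \<Longrightarrow> a \<le> b \<Longrightarrow> b < \<sigma> \<Longrightarrow> Hf h a \<le> Hf h b"
  unfolding Hf_def using h_nonneg h_integrable by (intro integral_subset_le) auto

lemma weight_nonneg: "0 \<le> weight t"
  by (simp add: weight_def)

lemma weight_antimono: "0 \<le> a \<Longrightarrow> a \<le> b \<Longrightarrow> weight b \<le> weight a"
  using Hf_mono[of a b] by (auto simp: weight_def)

lemma weight_continuous: "continuous_on {0..\<sigma>} weight"
  unfolding continuous_on_eq_continuous_within
proof
  fix t assume t: "t \<in> {0..\<sigma>}"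
  show "continuous (at t within {0..\<sigma>}) weight"
  proof (cases "t = \<sigma>")
    case True
    have "((\<lambda>t. exp (- Hf h t)) \<longlongrightarrow> 0) (at_left \<sigma>)"
      using Hf_at_top
      by (intro filterlim_compose[OF exp_at_bot]) (simp add: filterlim_uminus_at_top)
    then have "(weight \<longlongrightarrow> 0) (at_left \<sigma>)"
      by (rule Lim_transform_eventually) (auto simp: weight_def eventually_at_filter)
    then show ?thesis
      unfolding continuous_within True using \<sigma>_pos by (simp add: at_within_Icc_at_left weight_def)
  next
    case False
    have "continuous_on {0..<\<sigma>} weight"
      by (rule continuous_on_eq[OF continuous_on_exp[OF continuous_on_minus[OF Hf_continuous]]])
         (simp add: weight_def)
    then have "continuous (at t within {0..<\<sigma>}) weight"
      using t False by (simp add: continuous_on_eq_continuous_within)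
    moreover have "at t within {0..\<sigma>} = at t within {0..<\<sigma>}"
      using t False by (intro at_within_nhd[of t "{..<\<sigma>}"]) auto
    ultimately show ?thesis by simp
  qed
qed

lemma Psi_0: "Psi 0 = 0"
  by (simp add: Psi_def)

lemma Psi_continuous: "continuous_on {0..\<sigma>} Psi"
  unfolding Psi_def
  by (intro indefinite_integral_continuous_1 integrable_continuous_real weight_continuous)

lemma Psi_strict_mono: "strict_mono_on {0..\<sigma>} Psi"
proof (rule strict_mono_onI)
  fix a b assume ab: "a \<in> {0..\<sigma>}" "b \<in> {0..\<sigma>}" "a < b"
  show "Psi a < Psi b"
  proof (rule DERIV_pos_imp_increasing_open[OF \<open>a < b\<close>])
    fix t assume "a < t" "t < b"
    then have t: "0 < t" "t < \<sigma>"
      using ab by auto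
    have "(Psi has_real_derivative weight t) (at t within {0..\<sigma>})"
      unfolding Psi_def using t by (intro integral_has_real_derivative weight_continuous) simp
    then show "\<exists>y. (Psi has_real_derivative y) (at t) \<and> 0 < y"
      using t by (auto simp: at_within_Icc_at weight_def)
  qed (use ab in \<open>auto intro: continuous_on_subset[OF Psi_continuous]\<close>)
qed

lemma psi_eq_Psi: "s < \<sigma> \<Longrightarrow> psi h s = Psi s"
  unfolding psi_def Psi_def by (rule integral_cong) (simp add: weight_def)

lemma Lval_eq_Psi: "Lval h \<sigma> = Psi \<sigma>"
proof -
  have "Lval h \<sigma> = integral {0..<\<sigma>} weight"
    unfolding Lval_def by (rule integral_cong) (simp add: weight_def)
  also have "\<dots> = integral {0..\<sigma>} weight"
    by (intro integral_spike_set) (auto intro!: negligible_subset[OF negligible_sing[of \<sigma>]])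
  finally show ?thesis by (simp add: Psi_def)
qed

lemma Lval_pos: "0 < Lval h \<sigma>"
  using strict_mono_onD[OF Psi_strict_mono, of 0 \<sigma>] \<sigma>_pos by (simp add: Lval_eq_Psi Psi_0)

abbreviation Psi_inv :: "real \<Rightarrow> real" where
  "Psi_inv \<equiv> the_inv_into {0..\<sigma>} Psi"

lemma Psi_inv:
  shows Psi_image: "Psi ` {0..\<sigma>} = {0..Lval h \<sigma>}"
    and Psi_inv_continuous: "continuous_on {0..Lval h \<sigma>} Psi_inv"
    and Psi_inv_mono: "mono_on {0..Lval h \<sigma>} Psi_inv"
  using strict_mono_on_the_inv_into[OF less_imp_le[OF \<sigma>_pos] Psi_continuous Psi_strict_mono]
  by (simp_all add: Psi_0 Lval_eq_Psi)

lemma Psi_inv_in: "s \<in> {0..Lval h \<sigma>} \<Longrightarrow> Psi_inv s \<in> {0..\<sigma>}"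
  using the_inv_into_into[OF strict_mono_on_imp_inj_on[OF Psi_strict_mono], of s "{0..\<sigma>}"]
  by (simp add: Psi_image)

lemma gf_eq_weight:
  assumes "0 \<le> s"
  shows "gf h \<sigma> s = weight (Psi_inv (min s (Lval h \<sigma>)))"
proof -
  note inj = strict_mono_on_imp_inj_on[OF Psi_strict_mono]
  show ?thesis
  proof (cases "s < Lval h \<sigma>")
    case True
    then obtain t where t: "t \<in> {0..\<sigma>}" "Psi t = s"
      using assms Psi_image by (metis atLeastAtMost_iff image_iff less_imp_le)
    then have "t < \<sigma>"
      using True by (cases "t = \<sigma>") (auto simp: Lval_eq_Psi)
    moreover have "inj_on (psi h) {0..<\<sigma>}"
      by (subst inj_on_cong[of _ "psi h" Psi]) (auto simp: psi_eq_Psi intro: inj_on_subset[OF inj])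
    ultimately have "the_inv_into {0..<\<sigma>} (psi h) s = t"
      using t by (intro the_inv_into_f_eq) (auto simp: psi_eq_Psi)
    then show ?thesis
      using True t \<open>t < \<sigma>\<close> the_inv_into_f_eq[OF inj t(2,1)] by (simp add: gf_def weight_def)
  next
    case False
    then show ?thesis
      using the_inv_into_f_f[OF inj, of \<sigma>] \<sigma>_pos by (simp add: gf_def weight_def Lval_eq_Psi)
  qed
qed

lemma gf_nonneg: "0 \<le> s \<Longrightarrow> 0 \<le> gf h \<sigma> s"
  by (simp add: gf_eq_weight weight_nonneg)

lemma gf_Lval: "gf h \<sigma> (Lval h \<sigma>) = 0"
  by (simp add: gf_def)

lemma gf_antimono: "antimono_on {0..} (gf h \<sigma>)"
proof (rule monotone_onI)
  fix s t :: real assume "s \<in> {0..}" "t \<in> {0..}" "s \<le> t"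
  then have st: "min s (Lval h \<sigma>) \<in> {0..Lval h \<sigma>}" "min t (Lval h \<sigma>) \<in> {0..Lval h \<sigma>}"
    "min s (Lval h \<sigma>) \<le> min t (Lval h \<sigma>)"
    using Lval_pos by auto
  show "gf h \<sigma> t \<le> gf h \<sigma> s"
    using \<open>s \<in> {0..}\<close> \<open>t \<in> {0..}\<close> Psi_inv_in[OF st(1)] mono_onD[OF Psi_inv_mono st]
    by (simp add: gf_eq_weight weight_antimono)
qed

lemma gf_continuous: "continuous_on {0..} (gf h \<sigma>)"
proof (rule continuous_on_eq)
  show "continuous_on {0..} (\<lambda>s. weight (Psi_inv (min s (Lval h \<sigma>))))"
    using Lval_pos Psi_inv_in
    by (intro continuous_on_compose2[OF weight_continuous]
        continuous_on_compose2[OF Psi_inv_continuous]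
        continuous_intros) auto
qed (simp add: gf_eq_weight)

lemma gf_measurable: "gf h \<sigma> \<in> borel_measurable borel"
proof -
  have "psi h x \<noteq> s" if "s < 0" "x \<in> {0..<\<sigma>}" for s x
    using strict_mono_on_leD[OF Psi_strict_mono, of 0 x] that by (auto simp: psi_eq_Psi Psi_0)
  then have "(\<lambda>y. y \<in> {0..<\<sigma>} \<and> psi h y = s) = (\<lambda>y. False)" if "s < 0" for s
    using that by blast
  then have "gf h \<sigma> s = exp (- Hf h (THE y. False))" if "s < 0" for s
    using that Lval_pos unfolding gf_def the_inv_into_def by simp
  then have eq: "gf h \<sigma> = (\<lambda>s. if s < 0 then exp (- Hf h (THE y. False)) else gf h \<sigma> (max 0 s))"
    by (simp add: fun_eq_iff)
  have "continuous_on UNIV (\<lambda>s. gf h \<sigma> (max 0 s))"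
    by (intro continuous_on_compose2[OF gf_continuous] continuous_intros) auto
  then have [measurable]: "(\<lambda>s. gf h \<sigma> (max 0 s)) \<in> borel_measurable borel"
    by (rule borel_measurable_continuous_onI)
  show ?thesis
    by (subst eq) measurable
qed

end

section \<open>Existence and uniqueness\<close>

lemma (in finite_measure) integrable_of_integrable_powr:
  fixes f :: "'a \<Rightarrow> real"
  assumes "1 \<le> p" "f \<in> borel_measurable M" "integrable M (\<lambda>x. \<bar>f x\<bar> powr p)"
  shows "integrable M f"
proof (rule Bochner_Integration.integrable_bound)
  show "integrable M (\<lambda>x. 1 + \<bar>f x\<bar> powr p)"
    using assms(3) by simp
  have "\<bar>f x\<bar> \<le> 1 + \<bar>f x\<bar> powr p" for x
  proof (cases "\<bar>f x\<bar> \<le> 1")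
    case True
    then show ?thesis using powr_ge_zero[of "\<bar>f x\<bar>" p] by linarith
  next
    case False
    then show ?thesis using powr_mono[OF assms(1), of "\<bar>f x\<bar>"] by simp
  qed
  then show "AE x in M. norm (f x) \<le> norm (1 + \<bar>f x\<bar> powr p)"
    by simp
qed fact

lemma (in bounded_open_domain) integrable_of_Lp_on:
  assumes "1 \<le> p" "Lp_on \<Omega> p f"
  shows "integrable \<mu> f"
  by (rule integrable_of_integrable_powr[OF assms(1)]) (use assms(2) in \<open>simp_all add: Lp_on_def\<close>)

theorem theorem4p3:
  fixes \<Omega> :: "'a::euclidean_space set"
    and h :: "real \<Rightarrow> real" and f :: "'a \<Rightarrow> real"
    and \<sigma> \<gamma> C p \<rho> lam :: real
  assumes "open \<Omega>" and "bounded \<Omega>"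
    and "\<sigma> > 0"
    and "continuous_on {0..<\<sigma>} h"
    and "strict_mono_on {0..<\<sigma>} h"
    and "\<forall>s\<in>{0..<\<sigma>}. h s \<ge> 0"
    and "filterlim h at_top (at_left \<sigma>)"
    and "1 \<le> \<gamma>" and "\<gamma> < 2"
    and "C > 0"
    and "((\<lambda>s. (\<sigma> - s) powr \<gamma> * h s) \<longlongrightarrow> C) (at_left \<sigma>)"
    and "p \<ge> 1" and "p > real DIM('a) / 2"
    and "Lp_on \<Omega> p f"
    and "\<rho> > 0" and "AE x in lebesgue_on \<Omega>. f x \<ge> \<rho>"
    and "lam > 0"
  shows "\<exists>v G. H10 \<Omega> v G \<and>
           (AE x in lebesgue_on \<Omega>. 0 \<le> v x \<and> v x \<le> Lval h \<sigma>) \<and>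
           (\<forall>\<phi> D. H10 \<Omega> \<phi> D \<longrightarrow>
              integrable (lebesgue_on \<Omega>) (\<lambda>x. f x * gf h \<sigma> (v x) * \<phi> x) \<and>
              (LINT x|lebesgue_on \<Omega>. G x \<bullet> D x)
                = lam * (LINT x|lebesgue_on \<Omega>. f x * gf h \<sigma> (v x) * \<phi> x)) \<and>
           (\<forall>w W. H10 \<Omega> w W \<and>
              (AE x in lebesgue_on \<Omega>. 0 \<le> w x \<and> w x \<le> Lval h \<sigma>) \<and>
              (\<forall>\<phi> D. H10 \<Omega> \<phi> D \<longrightarrow>
                 (LINT x|lebesgue_on \<Omega>. W x \<bullet> D x)
                   = lam * (LINT x|lebesgue_on \<Omega>. f x * gf h \<sigma> (w x) * \<phi> x))
              \<longrightarrow> (AE x in lebesgue_on \<Omega>. w x = v x))"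
proof -
  interpret bounded_open_domain \<Omega>
    using assms by unfold_locales
  interpret singular_weight h \<sigma>
    using assms filterlim_Hf_at_top[OF _ _ _ eventually_inverse_distance_le[of \<gamma> C]]
    by unfold_locales auto
  have "AE x in \<mu>. 0 \<le> lam * f x"
    using \<open>AE x in \<mu>. f x \<ge> \<rho>\<close> by eventually_elim (use \<open>\<rho> > 0\<close> \<open>lam > 0\<close> in simp)
  then interpret semilinear_dirichlet \<Omega> "\<lambda>x. lam * f x" "gf h \<sigma>" "Lval h \<sigma>"
    using integrable_of_Lp_on[OF \<open>p \<ge> 1\<close> \<open>Lp_on \<Omega> p f\<close>] Lval_pos
    by unfold_locales (auto simp: gf_measurable gf_continuous gf_antimono gf_nonneg gf_Lval)
  obtain v G where v: "weak_solution \<Omega> (\<lambda>x. lam * f x * gf h \<sigma> (v x)) v G"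
    "AE x in \<mu>. 0 \<le> v x \<and> v x \<le> Lval h \<sigma>"
    by (rule solution_exists)
  have "integrable \<mu> (\<lambda>x. f x * gf h \<sigma> (v x) * \<phi> x) \<and>
      (LINT x|\<mu>. G x \<bullet> D x) = lam * (LINT x|\<mu>. f x * gf h \<sigma> (v x) * \<phi> x)" if "H10 \<Omega> \<phi> D" for \<phi> D
    using weak_solutionD(2,3)[OF v(1) that] \<open>lam > 0\<close> by (simp add: mult.assoc)
  moreover have "AE x in \<mu>. w x = v x"
    if "H10 \<Omega> w W" "AE x in \<mu>. 0 \<le> w x \<and> w x \<le> Lval h \<sigma>" "\<And>\<phi> D. H10 \<Omega> \<phi> D \<Longrightarrow>
      (LINT x|\<mu>. W x \<bullet> D x) = lam * (LINT x|\<mu>. f x * gf h \<sigma> (w x) * \<phi> x)" for w W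
    using v(2) that
    by (intro solution_unique[OF weak_solution_of_equation _ v(1)]) (auto simp: mult.assoc)
  ultimately show ?thesis
    using weak_solutionD(1)[OF v(1)] v(2) by blast
qed

end
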